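(* Let $G$ be a nearly balanced bipartite graph on $2n-1$ vertices. If $q(\widehat{G})\le n$, then $G$ is traceable unless $$G\in\Bigl(\bigcup_{k=1}^{\lfloor (n-1)/2\rfloor}\mathcal{S}_n^k\Bigr)\cup\Bigl(\bigcup_{k=0}^{\lfloor n/2\rfloor-1}\mathcal{T}_n^k\Bigr),$$ or $n=4$ and $G=L$, where $L$ is the tree on $7$ vertices obtained from the star $K_{1,3}$ by subdividing each edge exactly once.
   Context: Graphs are finite and simple. A bipartite graph comes with a fixed bipartition $\{X,Y\}$ (parts may be empty); it is nearly balanced if the sizes of its two parts differ by exactly $1$ (the roles of the two parts may be interchanged), so here the parts have sizes $n$ and $n-1$. A graph is traceable if it contains a spanning path (Hamilton path). $q(G)$ is the signless Laplacian spectral radius, i.e. the largest eigenvalue of $D(G)+A(G)$, where $A(G)$ is the adjacency matrix and $D(G)$ the diagonal degree matrix. The quasi-complement $\widehat{G}$ of a bipartite graph $G$ with bipartition $\{X,Y\}$ is the bipartite graph with the same vertex set and bipartition such that, for $x\in X$ and $y\in Y$, $xy\in E(\widehat G)$ if and only if $xy\notin E(G)$. Equality of graphs and membership in a family are up to isomorphism of bipartite graphs (possibly interchanging the two parts). $\mathcal{G}_{m,n}$ is the set of bipartite graphs with parts of sizes $|X|=m$, $|Y|=n$; $\varPhi_{m,n}$ is the edgeless member of $\mathcal{G}_{m,n}$. For bipartite graphs $G_1,G_2$ with bipartitions $\{X_1,Y_1\}$, $\{X_2,Y_2\}$, $G_1\sqcup G_2$ is the graph obtained from the disjoint union $G_1\cup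 G_2$ by adding all edges between $X_1$ and $Y_2$ and all edges between $Y_1$ and $X_2$ (its parts are $X_1\cup X_2$ and $Y_1\cup Y_2$). Define $\mathcal{S}_n^k=\{H\sqcup\varPhi_{k,n-k}: H\in\mathcal{G}_{n-k-1,k}\}$ for $1\le k\le (n-1)/2$, and $\mathcal{T}_n^k=\{H\sqcup\varPhi_{k+1,n-k-1}: H\in\mathcal{G}_{n-k-1,k}\}$ for $0\le k\le n/2-1$. *)

theory Defs
  imports "Jordan_Normal_Form.Char_Poly"
begin

text \<open>The bipartition is part of the data: isolated vertices belong to a definite part,
  and either part may be empty. Edges are two-element sets of vertices.\<close>

record 'a bigraph =
  partX :: "'a set"
  partY :: "'a set"
  edges :: "'a set set"

definition verts :: "'a bigraph \<Rightarrow> 'a set" where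
  "verts G = partX G \<union> partY G"

definition bipartite_graph :: "'a bigraph \<Rightarrow> bool" where
  "bipartite_graph G \<longleftrightarrow>
     finite (partX G) \<and> finite (partY G) \<and> partX G \<inter> partY G = {} \<and>
     edges G \<subseteq> {{x, y} | x y. x \<in> partX G \<and> y \<in> partY G}"

definition nearly_balanced :: "'a bigraph \<Rightarrow> bool" where
  "nearly_balanced G \<longleftrightarrow>
     card (partX G) = card (partY G) + 1 \<or> card (partY G) = card (partX G) + 1"

definition adjacent :: "'a bigraph \<Rightarrow> 'a \<Rightarrow> 'a \<Rightarrow> bool" where
  "adjacent G u v \<longleftrightarrow> {u, v} \<in> edges G"

definition vdegree :: "'a bigraph \<Rightarrow> 'a \<Rightarrow> nat" where
  "vdegree G v = card {u \<in> verts G. adjacent G v u}"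

definition hamilton_path :: "'a bigraph \<Rightarrow> 'a list \<Rightarrow> bool" where
  "hamilton_path G p \<longleftrightarrow>
     p \<noteq> [] \<and> distinct p \<and> set p = verts G \<and> successively (adjacent G) p"

definition traceable :: "'a bigraph \<Rightarrow> bool" where
  "traceable G \<longleftrightarrow> (\<exists>p. hamilton_path G p)"

definition quasi_complement :: "'a bigraph \<Rightarrow> 'a bigraph" where
  "quasi_complement G =
     \<lparr>partX = partX G, partY = partY G,
      edges = {{x, y} | x y. x \<in> partX G \<and> y \<in> partY G \<and> {x, y} \<notin> edges G}\<rparr>"

definition adjacency_matrix :: "'a list \<Rightarrow> 'a bigraph \<Rightarrow> real mat" where
  "adjacency_matrix vs G =
     mat (length vs) (length vs) (\<lambda>(i, j). if adjacent G (vs ! i) (vs ! j) then 1 else 0)"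

definition degree_matrix :: "'a list \<Rightarrow> 'a bigraph \<Rightarrow> real mat" where
  "degree_matrix vs G =
     mat (length vs) (length vs) (\<lambda>(i, j). if i = j then real (vdegree G (vs ! i)) else 0)"

text \<open>Rows and columns are indexed by an arbitrarily chosen enumeration of the vertices;
  another choice conjugates the matrix by a permutation matrix and so does not change the
  eigenvalues. The matrix is real symmetric, so for a nonempty vertex set its real
  eigenvalues form a finite nonempty set containing all its complex eigenvalues. For the
  empty graph the value of \<open>signless_radius\<close> is unspecified.\<close>

definition vertex_list :: "'a bigraph \<Rightarrow> 'a list" where
  "vertex_list G = (SOME vs. distinct vs \<and> set vs = verts G)"

definition signless_laplacian :: "'a bigraph \<Rightarrow> real mat" where
  "signless_laplacian G =
     degree_matrix (vertex_list G) G + adjacency_matrix (vertex_list G) G"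

definition signless_radius :: "'a bigraph \<Rightarrow> real" where
  "signless_radius G = Max {\<mu>. eigenvalue (signless_laplacian G) \<mu>}"

definition bigraph_iso :: "'a bigraph \<Rightarrow> 'b bigraph \<Rightarrow> bool" where
  "bigraph_iso G H \<longleftrightarrow>
     (\<exists>f. bij_betw f (verts G) (verts H) \<and>
          (f ` partX G = partX H \<and> f ` partY G = partY H \<or>
           f ` partX G = partY H \<and> f ` partY G = partX H) \<and>
          (\<forall>u \<in> verts G. \<forall>v \<in> verts G. adjacent G u v \<longleftrightarrow> adjacent H (f u) (f v)))"

definition bigraphs :: "nat \<Rightarrow> nat \<Rightarrow> 'a bigraph set" where
  "bigraphs m n = {G. bipartite_graph G \<and> card (partX G) = m \<and> card (partY G) = n}"

definition edgeless :: "nat \<Rightarrow> nat \<Rightarrow> (nat + nat) bigraph" where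
  "edgeless m n = \<lparr>partX = Inl ` {..<m}, partY = Inr ` {..<n}, edges = {}\<rparr>"

definition bigraph_join :: "'a bigraph \<Rightarrow> 'b bigraph \<Rightarrow> ('a + 'b) bigraph" (infixl "\<squnion>\<^sub>b" 65) where
  "G1 \<squnion>\<^sub>b G2 =
     \<lparr>partX = partX G1 <+> partX G2,
      partY = partY G1 <+> partY G2,
      edges = (\<lambda>e. Inl ` e) ` edges G1 \<union> (\<lambda>e. Inr ` e) ` edges G2
        \<union> {{Inl x, Inr y} | x y. x \<in> partX G1 \<and> y \<in> partY G2}
        \<union> {{Inl y, Inr x} | x y. y \<in> partY G1 \<and> x \<in> partX G2}\<rparr>"

text \<open>In the two families \<open>H\<close> ranges over graphs on natural numbers; every finite bipartite
  graph is isomorphic to such a graph, and membership is only used up to \<open>bigraph_iso\<close>.\<close>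

definition S_family :: "nat \<Rightarrow> nat \<Rightarrow> (nat + (nat + nat)) bigraph set" where
  "S_family n k = {H \<squnion>\<^sub>b edgeless k (n - k) | H :: nat bigraph. H \<in> bigraphs (n - k - 1) k}"

definition T_family :: "nat \<Rightarrow> nat \<Rightarrow> (nat + (nat + nat)) bigraph set" where
  "T_family n k =
     {H \<squnion>\<^sub>b edgeless (k + 1) (n - k - 1) | H :: nat bigraph. H \<in> bigraphs (n - k - 1) k}"

text \<open>Centre 0 and leaves 1, 2, 3 of the star, with subdividing vertices 4, 5, 6.\<close>

definition subdivided_claw :: "nat bigraph" where
  "subdivided_claw =
     \<lparr>partX = {0, 1, 2, 3}, partY = {4, 5, 6},
      edges = {{0, 4}, {4, 1}, {0, 5}, {5, 2}, {0, 6}, {6, 3}}\<rparr>"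

end

theory Submission
  imports Defs "HOL-Analysis.Function_Topology"
begin

text \<open>Let the parts be \<open>P\<close> and \<open>Q\<close> with \<open>n\<close> and \<open>n - 1\<close> vertices. If \<open>G\<close> is not traceable, adding a
  vertex joined to all of \<open>P\<close> gives a nonhamiltonian balanced graph; choose an edge-maximal
  nonhamiltonian supergraph keeping that vertex full, and let \<open>H\<close> be its quasi-complement. By maximality
  the ends of an edge of \<open>H\<close> are joined by a Hamilton path of the supergraph, and the crossover
  argument gives degree sum at least \<open>n\<close> in \<open>H\<close>. Since \<open>q \<le> n\<close>, testing the Rayleigh quotient of the
  quasi-complement of \<open>G\<close> on the degree function of \<open>H\<close> shows that these degree sums are exactly \<open>n\<close>
  and that the remaining edges of the quasi-complement avoid all nontrivial components of \<open>H\<close>. Then,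
  along every such Hamilton path, each index carries exactly one of the two crossing chords, and
  comparing the path with its rotations leaves two possibilities: either \<open>H\<close> contains a complete
  bipartite component on \<open>n\<close> vertices, which yields the two families, or the chords alternate, which
  forces \<open>n = 4\<close> and the subdivided claw.\<close>

section \<open>Rayleigh's principle for real symmetric matrices\<close>

text \<open>First-order optimality condition. If \<open>c\<close> were nonzero, a short step in the
  direction of \<open>c\<close> would make the expression positive: for
  \<open>e = c / (1 + \<bar>d\<bar>)\<close> the linear term is
  \<open>2 * (1 + \<bar>d\<bar>)\<close> times the square of \<open>e\<close>, which outweighs
  \<open>d\<close>.\<close>

lemma linear_coefficient_zero:
  fixes c d :: real
  assumes "\<And>e. 2 * e * c + e\<^sup>2 * d \<le> 0"
  shows "c = 0"
proof (rule ccontr)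
  assume c: "c \<noteq> 0"
  define e where "e = c / (1 + \<bar>d\<bar>)"
  have pos: "1 + \<bar>d\<bar> > 0" by simp
  have ec: "e * (1 + \<bar>d\<bar>) = c" using pos by (simp add: e_def)
  have "e \<noteq> 0" using ec c by auto
  have "2 * e * c + e\<^sup>2 * d = e\<^sup>2 * (2 * (1 + \<bar>d\<bar>) + d)"
    unfolding ec[symmetric] by (simp add: power2_eq_square algebra_simps)
  moreover have "e\<^sup>2 * (2 * (1 + \<bar>d\<bar>) + d) > 0"
    using \<open>e \<noteq> 0\<close> by (intro mult_pos_pos) (auto simp: abs_if)
  ultimately show False using assms[of e] by linarith
qed

text \<open>Tychonoff: the sphere is a closed subset of a product of intervals. Forcing the value 0
  outside \<open>I\<close> turns all other factors into singletons, so the index type may be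
  infinite.\<close>

lemma compact_unit_sphere_functions:
  fixes I :: "'i set"
  assumes "finite I"
  shows "compact {f :: 'i \<Rightarrow> real. (\<forall>i. i \<notin> I \<longrightarrow> f i = 0) \<and> (\<Sum>i\<in>I. (f i)\<^sup>2) = 1}" (is "compact ?K")
proof -
  define B where "B i = (if i \<in> I then {-1..1} else {0::real})" for i :: 'i
  have "compactin (product_topology (\<lambda>i. euclidean) UNIV) (PiE UNIV B)"
    by (subst compactin_PiE) (auto simp: B_def)
  then have "compact (PiE UNIV B)" by (simp add: euclidean_product_topology)
  moreover have "closed {f :: 'i \<Rightarrow> real. (\<Sum>i\<in>I. (f i)\<^sup>2) = 1}"
    by (intro closed_Collect_eq continuous_intros) auto
  ultimately have "compact (PiE UNIV B \<inter> {f. (\<Sum>i\<in>I. (f i)\<^sup>2) = 1})"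
    by (rule compact_Int_closed)
  moreover have "?K = PiE UNIV B \<inter> {f. (\<Sum>i\<in>I. (f i)\<^sup>2) = 1}"
  proof -
    have "\<bar>f i\<bar> \<le> 1" if "i \<in> I" "(\<Sum>i\<in>I. (f i)\<^sup>2) = 1" for f :: "'i \<Rightarrow> real" and i
    proof -
      have "(f i)\<^sup>2 \<le> (\<Sum>i\<in>I. (f i)\<^sup>2)" using assms that(1) by (intro member_le_sum) auto
      then show ?thesis using that by (simp add: abs_square_le_1)
    qed
    then have "f i \<in> B i" if "f \<in> ?K" for f i
      using that by (cases "i \<in> I") (auto simp: B_def abs_le_iff)
    moreover have "f i = 0" if "f i \<in> B i" "i \<notin> I" for f i using that by (simp add: B_def)
    ultimately show ?thesis by (auto simp: PiE_iff)
  qed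
  ultimately show ?thesis by simp
qed

text \<open>The quadratic form attains its maximum \<open>\<mu>\<close> on the compact unit sphere.
  Scaling extends the bound to every \<open>f\<close>, and stationarity of the maximiser
  \<open>g\<close> is the eigenvalue equation.\<close>

lemma Rayleigh_maximum:
  fixes M :: "'i \<Rightarrow> 'i \<Rightarrow> real"
  assumes fin: "finite I" and ne: "I \<noteq> {}" and sym: "\<And>i j. i \<in> I \<Longrightarrow> j \<in> I \<Longrightarrow> M i j = M j i"
  shows "\<exists>g \<mu>. (\<exists>i\<in>I. g i \<noteq> 0) \<and> (\<forall>i\<in>I. (\<Sum>j\<in>I. M i j * g j) = \<mu> * g i) \<and>
    (\<forall>f. (\<Sum>i\<in>I. \<Sum>j\<in>I. M i j * f i * f j) \<le> \<mu> * (\<Sum>i\<in>I. (f i)\<^sup>2))"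
proof -
  define K where "K = {f :: 'i \<Rightarrow> real. (\<forall>i. i \<notin> I \<longrightarrow> f i = 0) \<and> (\<Sum>i\<in>I. (f i)\<^sup>2) = 1}"
  define q where "q f = (\<Sum>i\<in>I. \<Sum>j\<in>I. M i j * f i * f j)" for f
  obtain i0 where i0: "i0 \<in> I" using ne by blast
  define e where "e i = (if i = i0 then 1 else 0 :: real)" for i
  have "(\<Sum>i\<in>I. (e i)\<^sup>2) = (\<Sum>i\<in>I. if i = i0 then 1 else 0)"
    by (rule sum.cong) (auto simp: e_def)
  then have "(\<Sum>i\<in>I. (e i)\<^sup>2) = 1" using fin i0 by simp
  moreover have "e i = 0" if "i \<notin> I" for i using that i0 by (auto simp: e_def)
  ultimately have "e \<in> K" by (auto simp: K_def)
  then have "K \<noteq> {}" by blast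
  moreover have "continuous_on K q"
    unfolding q_def
    by (intro continuous_intros continuous_on_subset[OF continuous_on_product_coordinates]) auto
  moreover have "compact K" unfolding K_def by (rule compact_unit_sphere_functions[OF fin])
  ultimately obtain g where g: "g \<in> K" and gmax: "\<And>f. f \<in> K \<Longrightarrow> q f \<le> q g"
    using continuous_attains_sup[of K q] by blast
  define \<mu> where "\<mu> = q g"
  have le: "q f \<le> \<mu> * (\<Sum>i\<in>I. (f i)\<^sup>2)" for f
  proof (cases "\<forall>i\<in>I. f i = 0")
    case True
    then show ?thesis by (simp add: q_def)
  next
    case False
    define s where "s = (\<Sum>i\<in>I. (f i)\<^sup>2)"
    have s: "s > 0" unfolding s_def using False fin by (auto intro!: sum_pos2)
    define h where "h i = (if i \<in> I then f i / sqrt s else 0)" for i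
    have "(\<Sum>i\<in>I. (h i)\<^sup>2) = (\<Sum>i\<in>I. (f i)\<^sup>2 / s)"
      using s by (intro sum.cong) (auto simp: h_def power_divide)
    also have "\<dots> = 1" using s by (simp add: sum_divide_distrib[symmetric] s_def[symmetric])
    finally have "h \<in> K" by (auto simp: h_def K_def)
    then have "q h \<le> \<mu>" using gmax by (simp add: \<mu>_def)
    moreover have "q h = q f / s"
      unfolding q_def sum_divide_distrib
      using s by (intro sum.cong refl) (auto simp: h_def)
    ultimately show ?thesis using s by (simp add: s_def[symmetric] field_simps)
  qed
  have eig: "(\<Sum>j\<in>I. M i j * g j) = \<mu> * g i" if i: "i \<in> I" for i
  proof -
    define r where "r = (\<Sum>j\<in>I. M i j * g j) - \<mu> * g i"
    \<comment> \<open>Perturb the maximiser by \<open>e\<close> in the single coordinate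
      \<open>i\<close> and apply \<open>le\<close>; the first-order coefficient is the residual
      \<open>r\<close> of the eigenvalue equation.\<close>
    have "2 * e * r + e\<^sup>2 * (M i i - \<mu>) \<le> 0" for e
    proof -
      define \<delta> where "\<delta> k = (if k = i then e else 0)" for k
      have d1: "(\<Sum>k\<in>I. F k * \<delta> k) = F i * e" for F
        using fin i by (simp add: \<delta>_def if_distrib[of "\<lambda>x. _ * x"] cong: if_cong)
      have "q (\<lambda>k. g k + \<delta> k) = q g + (\<Sum>k\<in>I. \<Sum>j\<in>I. M k j * g j * \<delta> k)
          + (\<Sum>k\<in>I. \<Sum>j\<in>I. M k j * g k * \<delta> j) + (\<Sum>k\<in>I. \<Sum>j\<in>I. M k j * \<delta> j * \<delta> k)"
        unfolding q_def by (simp add: algebra_simps sum.distrib)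
      also have "(\<Sum>k\<in>I. \<Sum>j\<in>I. M k j * g j * \<delta> k) = (\<Sum>j\<in>I. M i j * g j) * e"
        by (simp add: sum_distrib_right[symmetric] d1)
      also have "(\<Sum>k\<in>I. \<Sum>j\<in>I. M k j * g k * \<delta> j) = (\<Sum>j\<in>I. M i j * g j) * e"
        using sym i by (simp add: d1 sum_distrib_right[symmetric])
      also have "(\<Sum>k\<in>I. \<Sum>j\<in>I. M k j * \<delta> j * \<delta> k) = M i i * e * e"
        by (simp add: sum_distrib_right[symmetric] d1)
      finally have "q (\<lambda>k. g k + \<delta> k) = \<mu> + 2 * e * (\<Sum>j\<in>I. M i j * g j) + e\<^sup>2 * M i i"
        by (simp add: \<mu>_def power2_eq_square algebra_simps)
      moreover have "(\<Sum>k\<in>I. (g k + \<delta> k)\<^sup>2)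
          = (\<Sum>k\<in>I. (g k)\<^sup>2) + (\<Sum>k\<in>I. 2 * g k * \<delta> k) + (\<Sum>k\<in>I. \<delta> k * \<delta> k)"
        by (simp add: power2_eq_square algebra_simps sum.distrib)
      then have "(\<Sum>k\<in>I. (g k + \<delta> k)\<^sup>2) = 1 + 2 * g i * e + \<delta> i * e"
        using g unfolding d1 K_def by simp
      then have "(\<Sum>k\<in>I. (g k + \<delta> k)\<^sup>2) = 1 + 2 * e * g i + e\<^sup>2"
        by (simp add: \<delta>_def power2_eq_square)
      ultimately show ?thesis
        using le[of "\<lambda>k. g k + \<delta> k"] by (simp add: r_def algebra_simps)
    qed
    then have "r = 0" by (rule linear_coefficient_zero)
    then show ?thesis by (simp add: r_def)
  qed
  have "\<exists>i\<in>I. g i \<noteq> 0"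
  proof (rule ccontr)
    assume "\<not> (\<exists>i\<in>I. g i \<noteq> 0)"
    then have "(\<Sum>i\<in>I. (g i)\<^sup>2) = 0" by simp
    with g show False by (simp add: K_def)
  qed
  then show ?thesis using eig le unfolding q_def by blast
qed

lemma quadratic_form_le_Max_eigenvalue:
  fixes A :: "real mat"
  assumes A: "A \<in> carrier_mat N N" and N: "N > 0"
    and sym: "\<And>i j. i < N \<Longrightarrow> j < N \<Longrightarrow> A $$ (i, j) = A $$ (j, i)"
  shows "(\<Sum>i<N. \<Sum>j<N. A $$ (i, j) * f i * f j) \<le> Max {\<mu>. eigenvalue A \<mu>} * (\<Sum>i<N. (f i)\<^sup>2)"
proof -
  have ne: "{..<N} \<noteq> {}" using N by auto
  have sym': "A $$ (i, j) = A $$ (j, i)" if "i \<in> {..<N}" "j \<in> {..<N}" for i j using sym that by auto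
  have "\<exists>g \<mu>. (\<exists>i\<in>{..<N}. g i \<noteq> 0) \<and> (\<forall>i\<in>{..<N}. (\<Sum>j<N. A $$ (i, j) * g j) = \<mu> * g i) \<and>
    (\<forall>f. (\<Sum>i<N. \<Sum>j<N. A $$ (i, j) * f i * f j) \<le> \<mu> * (\<Sum>i<N. (f i)\<^sup>2))"
    by (rule Rayleigh_maximum[OF finite_lessThan ne sym'])
  then obtain g \<mu> where g: "\<exists>i\<in>{..<N}. g i \<noteq> 0"
    and eig: "\<forall>i\<in>{..<N}. (\<Sum>j<N. A $$ (i, j) * g j) = \<mu> * g i"
    and le: "\<forall>f. (\<Sum>i<N. \<Sum>j<N. A $$ (i, j) * f i * f j) \<le> \<mu> * (\<Sum>i<N. (f i)\<^sup>2)"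
    by (elim exE conjE)
  have "eigenvector A (vec N g) \<mu>"
    unfolding eigenvector_def
  proof (intro conjI)
    show "vec N g \<in> carrier_vec (dim_row A)" using A by auto
    show "vec N g \<noteq> 0\<^sub>v (dim_row A)"
      using g A by (auto simp: vec_eq_iff)
    show "A *\<^sub>v vec N g = \<mu> \<cdot>\<^sub>v vec N g"
    proof (rule eq_vecI)
      fix i assume "i < dim_vec (\<mu> \<cdot>\<^sub>v vec N g)"
      then show "(A *\<^sub>v vec N g) $ i = (\<mu> \<cdot>\<^sub>v vec N g) $ i"
        using eig A by (auto simp: scalar_prod_def lessThan_atLeast0)
    qed (use A in auto)
  qed
  then have "eigenvalue A \<mu>" by (auto simp: eigenvalue_def)
  \<comment> \<open>\<open>Max\<close> dominates its elements only on a finite set; the eigenvalues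
    are roots of a monic polynomial.\<close>
  moreover have "finite {\<mu>. eigenvalue A \<mu>}"
  proof -
    have "char_poly A \<noteq> 0" using degree_monic_char_poly[OF A] by auto
    then show ?thesis unfolding eigenvalue_root_char_poly[OF A] by (rule poly_roots_finite)
  qed
  ultimately have "\<mu> \<le> Max {\<mu>. eigenvalue A \<mu>}" by simp
  then have "\<mu> * (\<Sum>i<N. (f i)\<^sup>2) \<le> Max {\<mu>. eigenvalue A \<mu>} * (\<Sum>i<N. (f i)\<^sup>2)"
    by (intro mult_right_mono sum_nonneg) auto
  with le[rule_format, of f] show ?thesis by linarith
qed

section \<open>Alternating spanning paths\<close>

text \<open>\<open>zigzag\<close> describes the spanning path \<open>a 0, b 0, a 1, b 1, \<dots>, a (n - 1), b (n - 1)\<close>. For \<open>n = 1\<close>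
  the notion \<open>hamiltonian\<close> is degenerate: a single edge counts as a closed path.\<close>

definition zigzag ::
  "nat \<Rightarrow> ('x \<Rightarrow> 'y \<Rightarrow> bool) \<Rightarrow> 'x set \<Rightarrow> 'y set \<Rightarrow> (nat \<Rightarrow> 'x) \<Rightarrow> (nat \<Rightarrow> 'y) \<Rightarrow> bool" where
  "zigzag n R X Y a b \<longleftrightarrow> bij_betw a {..<n} X \<and> bij_betw b {..<n} Y \<and>
     (\<forall>i<n. R (a i) (b i)) \<and> (\<forall>i. Suc i < n \<longrightarrow> R (a (Suc i)) (b i))"

definition hamiltonian :: "nat \<Rightarrow> ('x \<Rightarrow> 'y \<Rightarrow> bool) \<Rightarrow> 'x set \<Rightarrow> 'y set \<Rightarrow> bool" where
  "hamiltonian n R X Y \<longleftrightarrow> (\<exists>a b. zigzag n R X Y a b \<and> R (a 0) (b (n - 1)))"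

lemma zigzagD:
  assumes "zigzag n R X Y a b"
  shows "bij_betw a {..<n} X" "bij_betw b {..<n} Y"
    "\<And>i. i < n \<Longrightarrow> R (a i) (b i)" "\<And>i. Suc i < n \<Longrightarrow> R (a (Suc i)) (b i)"
  using assms by (auto simp: zigzag_def)

section \<open>Reversal and rotation of alternating paths\<close>

lemma bij_betw_involution:
  assumes "\<And>k. k \<in> S \<Longrightarrow> f k \<in> S" "\<And>k. k \<in> S \<Longrightarrow> f (f k) = k"
  shows "bij_betw f S S"
  using assms by (intro bij_betw_byWitness[where f' = f]) auto

text \<open>Read backwards, the path starts in \<open>Y\<close>. This symmetry turns facts about the
  first vertex into facts about the last one.\<close>

lemma zigzag_reverse:
  assumes z: "zigzag n R X Y a b"
  shows "zigzag n (\<lambda>y x. R x y) Y X (\<lambda>k. b (n - 1 - k)) (\<lambda>k. a (n - 1 - k))"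
proof -
  have bij: "bij_betw (\<lambda>k. n - 1 - k) {..<n} {..<n}"
    by (rule bij_betw_involution) auto
  have "R (a (n - 1 - i)) (b (n - 1 - Suc i))" if "Suc i < n" for i
    using zigzagD(4)[OF z, of "n - 1 - Suc i"] that by (simp add: Suc_diff_Suc)
  then show ?thesis
    using bij_betw_trans[OF bij zigzagD(1)[OF z]] bij_betw_trans[OF bij zigzagD(2)[OF z]]
      zigzagD(3)[OF z]
    by (auto simp: zigzag_def o_def)
qed

text \<open>Posa rotation: the edge from \<open>a i\<close> to \<open>b i\<close> is exchanged for
  the chord from \<open>a 0\<close> to \<open>b i\<close>, and the segment from \<open>a 0\<close>
  to \<open>a i\<close> is traversed backwards. The new first vertex is \<open>a i\<close>; the last
  vertex stays.\<close>

lemma zigzag_rotate: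
  assumes z: "zigzag n R X Y a b" and i: "i < n" and Ri: "R (a 0) (b i)"
  shows "zigzag n R X Y (\<lambda>k. if k \<le> i then a (i - k) else a k)
    (\<lambda>k. if k < i then b (i - 1 - k) else b k)"
proof -
  have 1: "bij_betw (\<lambda>k. if k \<le> i then i - k else k) {..<n} {..<n}"
    using i by (intro bij_betw_involution) auto
  have 2: "bij_betw (\<lambda>k. if k < i then i - 1 - k else k) {..<n} {..<n}"
    using i by (intro bij_betw_involution) auto
  have "bij_betw (\<lambda>k. if k \<le> i then a (i - k) else a k) {..<n} X"
    using bij_betw_trans[OF 1 zigzagD(1)[OF z]] by (simp add: o_def if_distrib[of a])
  moreover have "bij_betw (\<lambda>k. if k < i then b (i - 1 - k) else b k) {..<n} Y"
    using bij_betw_trans[OF 2 zigzagD(2)[OF z]] by (simp add: o_def if_distrib[of b])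
  moreover have "R (if k \<le> i then a (i - k) else a k) (if k < i then b (i - 1 - k) else b k)"
    if "k < n" for k
  proof -
    consider "k < i" | "k = i" | "k > i" by linarith
    then show ?thesis
    proof cases
      case 1
      then show ?thesis using zigzagD(4)[OF z, of "i - 1 - k"] i by (simp add: Suc_diff_Suc)
    qed (use Ri zigzagD(3)[OF z that] in auto)
  qed
  moreover have "R (if Suc k \<le> i then a (i - Suc k) else a (Suc k))
      (if k < i then b (i - 1 - k) else b k)"
    if "Suc k < n" for k
    using zigzagD(3)[OF z, of "i - Suc k"] zigzagD(4)[OF z that] i by auto
  ultimately show ?thesis by (simp add: zigzag_def)
qed

text \<open>The rotation at the other end, obtained by reversing, rotating and reversing again. Of
  the \<open>X\<close>-side only the first vertex is recorded, since later arguments look only at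
  its neighbours among the explicitly listed \<open>Y\<close>-vertices.\<close>

lemma zigzag_rotate_end:
  assumes z: "zigzag n R X Y a b" and i: "i < n" and Ri: "R (a i) (b (n - 1))"
  shows "\<exists>c. zigzag n R X Y c (\<lambda>k. if k < i then b k else b (n - 1 + i - k)) \<and> c 0 = a 0"
proof -
  let ?a = "\<lambda>k. b (n - 1 - k)" and ?b = "\<lambda>k. a (n - 1 - k)"
  let ?i = "n - 1 - i"
  have "zigzag n (\<lambda>y x. R x y) Y X (\<lambda>k. if k \<le> ?i then ?a (?i - k) else ?a k)
      (\<lambda>k. if k < ?i then ?b (?i - 1 - k) else ?b k)"
    by (rule zigzag_rotate[OF zigzag_reverse[OF z]]) (use i Ri in auto)
  from zigzag_reverse[OF this]
  have *: "zigzag n R X Y (\<lambda>k. if n - 1 - k < ?i then ?b (?i - 1 - (n - 1 - k)) else ?b (n - 1 - k))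
      (\<lambda>k. if n - 1 - k \<le> ?i then ?a (?i - (n - 1 - k)) else ?a (n - 1 - k))"
    (is "zigzag n R X Y ?c ?d") .
  have d: "?d k = (if k < i then b k else b (n - 1 + i - k))" if "k < n" for k
  proof -
    consider "k < i" | "i \<le> k" by linarith
    then show ?thesis
    proof cases
      case 1
      then have "\<not> n - 1 - k \<le> ?i" "n - 1 - (n - 1 - k) = k" using i by auto
      then show ?thesis using 1 by simp
    next
      case 2
      then have "n - 1 - k \<le> ?i" "n - 1 - (?i - (n - 1 - k)) = n - 1 + i - k" using i that by auto
      then show ?thesis using 2 by simp
    qed
  qed
  have "zigzag n R X Y ?c (\<lambda>k. if k < i then b k else b (n - 1 + i - k))"
    using * d bij_betw_cong[of "{..<n}" ?d "\<lambda>k. if k < i then b k else b (n - 1 + i - k)" Y]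
    by (auto simp: zigzag_def)
  moreover have "?c 0 = a 0" using i by auto
  ultimately show ?thesis by blast
qed

text \<open>In a nonhamiltonian relation the two conditions below exclude each other; if moreover the
  end points have degree sum \<open>n\<close>, exactly one of them holds for every index.\<close>

definition tight :: "nat \<Rightarrow> ('x \<Rightarrow> 'y \<Rightarrow> bool) \<Rightarrow> 'x set \<Rightarrow> 'y set \<Rightarrow> bool" where
  "tight n R X Y \<longleftrightarrow> (\<forall>a b. zigzag n R X Y a b \<longrightarrow>
     (\<forall>i<n. R (a 0) (b i) \<longleftrightarrow> \<not> R (a i) (b (n - 1))))"

section \<open>Adjacencies forced by tightness under rotation\<close>

lemma tightD:
  "tight n R X Y \<Longrightarrow> zigzag n R X Y a b \<Longrightarrow> i < n \<Longrightarrow> R (a i) (b (n - 1)) \<longleftrightarrow> \<not> R (a 0) (b i)"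
  unfolding tight_def by blast

lemma tight_transpose:
  assumes "tight n R X Y"
  shows "tight n (\<lambda>y x. R x y) Y X"
  unfolding tight_def
proof (intro allI impI)
  fix a b i
  assume z: "zigzag n (\<lambda>y x. R x y) Y X a b" and i: "i < n"
  have "n - Suc (n - Suc i) = i" using i by simp
  then show "R (b i) (a 0) \<longleftrightarrow> \<not> R (b (n - 1)) (a i)"
    using tightD[OF assms zigzag_reverse[OF z], of "n - 1 - i"] i by auto
qed

context
  fixes n :: nat and R :: "'x \<Rightarrow> 'y \<Rightarrow> bool" and X :: "'x set" and Y :: "'y set" and a b
  assumes t: "tight n R X Y" and z: "zigzag n R X Y a b"
begin

text \<open>Rotating at \<open>i\<close> makes \<open>a i\<close> the first vertex and changes
  neither the positions after \<open>i\<close> nor the last vertex. Tightness of both paths then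
  ties either side to the same chord from \<open>a k\<close> to \<open>b (n - 1)\<close>.\<close>

lemma first_nbr_later:
  assumes "R (a 0) (b i)" "i < k" "k < n"
  shows "R (a i) (b k) \<longleftrightarrow> R (a 0) (b k)"
proof -
  have "\<not> n - 1 < i" using assms by simp
  then show ?thesis
    using tightD[OF t zigzag_rotate[OF z _ assms(1)], of k] tightD[OF t z, of k] assms by auto
qed

text \<open>As before, but in the reversed segment \<open>b j\<close> shares its position with
  \<open>a (Suc j)\<close>; this causes the index shift.\<close>

lemma first_nbr_earlier:
  assumes "R (a 0) (b i)" "j < i" "i < n"
  shows "R (a i) (b j) \<longleftrightarrow> R (a 0) (b (Suc j))"
proof -
  have "\<not> n - 1 < i" "i - (i - 1 - j) = Suc j" using assms by auto
  then show ?thesis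
    using tightD[OF t zigzag_rotate[OF z _ assms(1)], of "i - 1 - j"] tightD[OF t z, of "Suc j"] assms
    by auto
qed

end

context
  fixes n :: nat and R :: "'x \<Rightarrow> 'y \<Rightarrow> bool" and X :: "'x set" and Y :: "'y set" and a b
  assumes t: "tight n R X Y" and z: "zigzag n R X Y a b"
begin

text \<open>Mirror image of \<open>first_nbr_later\<close>: by tightness a non-neighbour
  \<open>b j\<close> of \<open>a 0\<close> provides the chord from \<open>a j\<close> to the last
  vertex, so \<open>b j\<close> can be rotated to the end.\<close>

lemma last_nbr_earlier:
  assumes "\<not> R (a 0) (b j)" "k < j" "j < n"
  shows "R (a k) (b j) \<longleftrightarrow> \<not> R (a 0) (b k)"
  using first_nbr_later[OF tight_transpose[OF t] zigzag_reverse[OF z], of "n - 1 - j" "n - 1 - k"]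
    tightD[OF t z, of j] tightD[OF t z, of k] assms
  by auto

lemma last_nbr_later:
  assumes "\<not> R (a 0) (b j)" "j < k" "k < n"
  shows "R (a k) (b j) \<longleftrightarrow> \<not> R (a 0) (b (k - 1))"
proof -
  have "n - 1 - Suc (n - 1 - k) = k - 1" using assms by auto
  then show ?thesis
    using first_nbr_earlier[OF tight_transpose[OF t] zigzag_reverse[OF z], of "n - 1 - j" "n - 1 - k"]
      tightD[OF t z, of j] tightD[OF t z, of "k - 1"] assms
    by auto
qed

text \<open>Otherwise the pair \<open>a (j + 2)\<close>, \<open>b j\<close> could be evaluated by
  rotating at the front and by rotating at the end, with opposite answers in terms of
  \<open>b (j + 1)\<close>.\<close>

lemma nbr_step:
  assumes "R (a 0) (b (j + 2))" "j + 2 < n"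
  shows "R (a 0) (b j)"
  using first_nbr_earlier[OF t z assms(1), of j] last_nbr_later[of j "j + 2"] assms by auto

lemma nbr_step_mult:
  assumes "R (a 0) (b (j + 2 * m))" "j + 2 * m < n"
  shows "R (a 0) (b j)"
  using assms
proof (induction m)
  case (Suc m)
  then show ?case using nbr_step[of "j + 2 * m"] by simp
qed simp

end

text \<open>If the neighbours of \<open>a 0\<close> are not an initial segment, rotating the path at both ends gives
  a second one, and \<open>nbr_step\<close> applied to both forces the neighbours to alternate.\<close>

lemma alternating:
  assumes t: "tight n R X Y" and z: "zigzag n R X Y a b"
    and i: "R (a 0) (b i)" "\<not> R (a 0) (b (i - 1))" "i < n"
  shows "even n \<and> n \<ge> 4 \<and> (\<forall>k<n. R (a 0) (b k) \<longleftrightarrow> even k)"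
proof -
  have b0: "R (a 0) (b 0)" and bl: "\<not> R (a 0) (b (n - 1))"
    using zigzagD(3)[OF z] tightD[OF t z, of 0] i(3) by auto
  have i1: "i \<noteq> 0" using i by (cases i) auto
  moreover have "i \<noteq> 1" using i b0 by auto
  ultimately have i2: "i \<ge> 2" by simp
  have in1: "i < n - 1" using i bl by (cases "i = n - 1") auto
  define a' where "a' = (\<lambda>k. if k \<le> i then a (i - k) else a k)"
  define b' where "b' = (\<lambda>k. if k < i then b (i - 1 - k) else b k)"
  have z1: "zigzag n R X Y a' b'"
    unfolding a'_def b'_def by (rule zigzag_rotate[OF z i(3) i(1)])
  have a0: "a' 0 = a i" and a1: "a' 1 = a (i - 1)" and bn: "b' (n - 1) = b (n - 1)"
    using i2 in1 by (auto simp: a'_def b'_def)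
  have "i - 1 < n" using i(3) by simp
  \<comment> \<open>The non-neighbour \<open>b (i - 1)\<close> yields a chord from
    \<open>a (i - 1)\<close> to the last vertex. After the first rotation \<open>a (i - 1)\<close>
    has position 1, so the end is rotated there.\<close>
  with i(2) have "R (a (i - 1)) (b (n - 1))" using tightD[OF t z, of "i - 1"] by blast
  then have R1: "R (a' 1) (b' (n - 1))" unfolding a1 bn .
  have "1 < n" using in1 by simp
  define d where "d = (\<lambda>k. if k < 1 then b' k else b' (n - 1 + 1 - k))"
  obtain c where z2: "zigzag n R X Y c d" and "c 0 = a' 0"
    using zigzag_rotate_end[OF z1 \<open>1 < n\<close> R1] unfolding d_def by blast
  then have c: "c 0 = a i" unfolding a0 by simp
  \<comment> \<open>Along the second path the \<open>Y\<close>-vertices come in the order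
    \<open>b (i - 1)\<close>, then \<open>b (n - 1)\<close> down to \<open>b i\<close>, then
    \<open>b 0\<close> up to \<open>b (i - 2)\<close>.\<close>
  have d_large: "d k = b (n - k)" if "1 \<le> k" "k \<le> n - i" for k
    using that in1 by (auto simp: d_def b'_def)
  have d_small: "d k = b (k - (n - i) - 1)" if "n - i < k" "k < n" for k
  proof -
    have "i - 1 - (n - k) = k - (n - i) - 1" using that i(3) by linarith
    then show ?thesis using that in1 by (auto simp: d_def b'_def)
  qed
  have R1: "R (c 0) (d k) \<longleftrightarrow> R (a 0) (b (n - k))" if "1 \<le> k" "k < n - i" for k
    unfolding c d_large[of k, OF that(1) less_imp_le[OF that(2)]]
    by (rule first_nbr_later[OF t z i(1)]) (use that in auto)
  have R2: "R (c 0) (d k) \<longleftrightarrow> R (a 0) (b (k - (n - i)))" if "n - i < k" "k < n" for k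
    unfolding c d_small[OF that]
    using first_nbr_earlier[OF t z i(1), of "k - (n - i) - 1"] that i(3) by (auto simp: Suc_diff_Suc)
  have R3: "R (c 0) (d (n - i))"
    using zigzagD(3)[OF z i(3)] d_large[of "n - i"] in1 i(3) by (auto simp: c)
  have nd1: "\<not> R (c 0) (d 1)" using R1[of 1] bl in1 by auto
  \<comment> \<open>Descending in steps of two, a neighbour at an odd position would lead to
    position 1, which is excluded by \<open>nd1\<close>.\<close>
  have odd_no: "\<not> R (c 0) (d k)" if "odd k" "k < n" for k
  proof
    assume "R (c 0) (d k)"
    moreover obtain m where "k = 2 * m + 1" using \<open>odd k\<close> by (elim oddE)
    then have "k = 1 + 2 * m" by simp
    ultimately show False using nbr_step_mult[OF t z2, of 1 m] nd1 that(2) by blast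
  qed
  have ev: "even (n - i)" using odd_no[of "n - i"] R3 i2 i(3) by auto
  \<comment> \<open>This odd position carries \<open>b 0\<close>, and by \<open>R2\<close> its
    status is that of \<open>b 1\<close> on the original path; the same descent then works
    there.\<close>
  have "\<not> R (c 0) (d (n - i + 1))" using odd_no[of "n - i + 1"] ev i2 i(3) by auto
  then have nb1: "\<not> R (a 0) (b 1)" using R2[of "n - i + 1"] i2 i(3) by auto
  have odd_no': "\<not> R (a 0) (b k)" if "odd k" "k < n" for k
  proof
    assume "R (a 0) (b k)"
    moreover obtain m where "k = 2 * m + 1" using \<open>odd k\<close> by (elim oddE)
    then have "k = 1 + 2 * m" by simp
    ultimately show False using nbr_step_mult[OF t z, of 1 m] nb1 that(2) by blast
  qed
  have "even i" using odd_no'[of i] i by auto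
  with ev have en: "even n" using i(3) by auto
  \<comment> \<open>The neighbour at the even position \<open>n - i\<close> of the second path
    descends to position 2, which carries \<open>b (n - 2)\<close>.\<close>
  have "R (a 0) (b (n - 2))"
  proof (cases "n - 2 = i")
    case True
    then show ?thesis using i by auto
  next
    case False
    have "n - i \<ge> 2" "even (n - i - 2)" using ev in1 by auto
    then obtain m where "n - i - 2 = 2 * m" by (elim evenE)
    with \<open>n - i \<ge> 2\<close> have m: "n - i = 2 + 2 * m" by linarith
    have "R (c 0) (d 2)" using nbr_step_mult[OF t z2, of 2 m] R3 m i(3) i2 by auto
    then show ?thesis using R1[of 2] False in1 i2 en \<open>even i\<close> by auto
  qed
  have even_yes: "R (a 0) (b k)" if "even k" "k < n" for k
  proof -
    have "k \<le> n - 2" using that en by (cases "k = n - 1") auto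
    then have "even (n - 2 - k)" using that en by auto
    then obtain m where "n - 2 - k = 2 * m" by (elim evenE)
    then have "n - 2 = k + 2 * m" using \<open>k \<le> n - 2\<close> by simp
    with \<open>R (a 0) (b (n - 2))\<close> show ?thesis
      using nbr_step_mult[OF t z, of k m] in1 by auto
  qed
  show ?thesis using even_yes odd_no' en i2 in1 by auto
qed

lemma card_filter_bij:
  assumes "bij_betw b I Y"
  shows "card {y \<in> Y. P y} = card {i \<in> I. P (b i)}"
proof -
  have "{y \<in> Y. P y} = b ` {i \<in> I. P (b i)}" using assms by (auto simp: bij_betw_def)
  also have "card \<dots> = card {i \<in> I. P (b i)}"
    using assms by (intro card_image) (auto simp: bij_betw_def intro: inj_on_subset)
  finally show ?thesis .
qed

text \<open>If the neighbour indices of \<open>a 0\<close> form an initial segment, they cut out the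
  blocks \<open>A\<close> and \<open>B\<close>. Otherwise they alternate; then the full vertex
  \<open>y0\<close> can only be \<open>b (n - 2)\<close>, and comparing the degrees of
  \<open>a 0\<close> and \<open>a 3\<close> leaves \<open>n = 4\<close>.\<close>

lemma tight_structure:
  assumes t: "tight n R X Y" and z: "zigzag n R X Y a b" and n: "n \<ge> 1"
    and full: "y0 \<in> Y" "\<forall>x\<in>X. R x y0"
    and deg: "\<forall>x\<in>X. \<forall>x'\<in>X. \<forall>y\<in>Y. \<not> R x y \<longrightarrow> \<not> R x' y \<longrightarrow>
      card {y \<in> Y. R x y} = card {y \<in> Y. R x' y}"
  shows "(\<exists>A\<subseteq>X. \<exists>B\<subseteq>Y. A \<noteq> {} \<and> B \<noteq> {} \<and> card A + card B = n \<and>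
      (\<forall>x\<in>A. \<forall>y\<in>Y. R x y \<longleftrightarrow> y \<notin> B) \<and> (\<forall>y\<in>B. \<forall>x\<in>X. R x y \<longleftrightarrow> x \<notin> A)) \<or>
    (n = 4 \<and> y0 = b 2 \<and> (\<forall>k<4. \<forall>j<4. R (a k) (b j) \<longleftrightarrow>
      (k, j) \<in> {(0,0),(0,2),(1,0),(1,1),(1,2),(1,3),(2,1),(2,2),(3,2),(3,3)}))"
proof -
  note full = full(1) full(2)[rule_format] and deg = deg[rule_format]
  define W where "W i \<longleftrightarrow> R (a 0) (b i)" for i
  have a: "bij_betw a {..<n} X" and b: "bij_betw b {..<n} Y" using z by (auto simp: zigzag_def)
  have W0: "W 0" and Wl: "\<not> W (n - 1)"
    using zigzagD(3)[OF z] tightD[OF t z, of 0] n by (auto simp: W_def)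
  note rules = first_nbr_later[OF t z, folded W_def] first_nbr_earlier[OF t z, folded W_def]
    last_nbr_earlier[OF t z, folded W_def] last_nbr_later[OF t z, folded W_def]
  show ?thesis
  proof (cases "\<exists>i<n. W i \<and> \<not> W (i - 1)")
    case False
    then have step: "W i" if "W (Suc i)" "Suc i < n" for i using that by force
    have anti: "W i" if "W j" "i \<le> j" "j < n" for i j
      using that(2,1,3) by (induction rule: dec_induct) (use step in auto)
    \<comment> \<open>With an initial segment, every \<open>a i\<close> with \<open>W i\<close> has
      the neighbourhood of \<open>a 0\<close>; \<open>RB\<close> is the dual fact for the last
      vertex. Monotonicity absorbs the index shifts of the rotation rules.\<close>
    have RA: "R (a i) (b j) \<longleftrightarrow> W j" if "W i" "i < n" "j < n" for i j
    proof -
      consider "i < j" | "i = j" | "j < i" by linarith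
      then show ?thesis
      proof cases
        case 3
        then show ?thesis using rules(2)[OF that(1) 3 that(2)] anti[OF that(1), of j]
            anti[OF that(1), of "Suc j"] that by auto
      qed (use rules(1)[OF that(1)] zigzagD(3)[OF z] that in auto)
    qed
    have RB: "R (a i) (b j) \<longleftrightarrow> \<not> W i" if "\<not> W j" "i < n" "j < n" for i j
    proof -
      consider "i < j" | "i = j" | "j < i" by linarith
      then show ?thesis
      proof cases
        case 3
        then have "j \<le> i - 1" "i - 1 < n" using that by auto
        then have "\<not> W i" "\<not> W (i - 1)" using anti[of i j] anti[of "i - 1" j] 3 that by auto
        then show ?thesis using rules(4)[OF that(1) 3 that(2)] by simp
      qed (use rules(3)[OF that(1)] zigzagD(3)[OF z] that in auto)
    qed
    let ?I = "{i. i < n \<and> W i}" and ?J = "{i. i < n \<and> \<not> W i}"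
    have inj: "inj_on a {..<n}" "inj_on b {..<n}" using a b by (auto simp: bij_betw_def)
    have mem: "a i \<in> a ` ?I \<longleftrightarrow> W i" "b i \<in> b ` ?J \<longleftrightarrow> \<not> W i" if "i < n" for i
      using that inj by (auto dest: inj_onD)
    have "card (a ` ?I) + card (b ` ?J) = card ?I + card ?J"
      using inj by (auto intro!: arg_cong2[of _ _ _ _ "(+)"] card_image intro: inj_on_subset)
    also have "\<dots> = card (?I \<union> ?J)" by (rule card_Un_disjoint[symmetric]) auto
    also have "?I \<union> ?J = {..<n}" by auto
    finally have "card (a ` ?I) + card (b ` ?J) = n" by simp
    moreover have "a ` ?I \<subseteq> X" "b ` ?J \<subseteq> Y" using a b by (auto simp: bij_betw_def)
    moreover have "0 \<in> ?I" "n - 1 \<in> ?J" using W0 Wl n by auto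
    then have "a ` ?I \<noteq> {}" "b ` ?J \<noteq> {}" by blast+
    moreover have X: "X = a ` {..<n}" and Y: "Y = b ` {..<n}" using a b by (auto simp: bij_betw_def)
    have "\<forall>x\<in>a ` ?I. \<forall>y\<in>Y. R x y \<longleftrightarrow> y \<notin> b ` ?J"
      unfolding Y using RA mem(2) by auto
    moreover have "\<forall>y\<in>b ` ?J. \<forall>x\<in>X. R x y \<longleftrightarrow> x \<notin> a ` ?I"
      unfolding X using RB mem(1) by auto
    ultimately show ?thesis
      by (intro disjI1 exI[of _ "a ` ?I"] exI[of _ "b ` ?J"] conjI)
  next
    case True
    then obtain i where "W i" "\<not> W (i - 1)" "i < n" by blast
    from alternating[OF t z this[unfolded W_def], folded W_def]
    have en: "even n" and n4: "n \<ge> 4" and W: "\<And>k. k < n \<Longrightarrow> W k \<longleftrightarrow> even k" by auto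
    have a_in: "a k \<in> X" and b_in: "b k \<in> Y" if "k < n" for k
      using a b that by (auto simp: bij_betw_def)
    obtain k where k: "k < n" "b k = y0" using b full(1) by (auto simp: bij_betw_def)
    \<comment> \<open>A full vertex must be adjacent to \<open>a 0\<close>, so its index is even; it
      cannot have an index below \<open>n - 2\<close>, since \<open>a (k + 2)\<close> would miss
      it.\<close>
    have "even k" using W[OF k(1)] full(2)[OF a_in[of 0]] k n by (auto simp: W_def)
    moreover have "\<not> k + 2 < n"
    proof
      assume k2: "k + 2 < n"
      then have "\<not> R (a (k + 2)) (b k)"
        using rules(2)[of "k + 2" k] W[of "k + 2"] W[of "Suc k"] \<open>even k\<close> by auto
      then show False using full(2) a_in[OF k2] k by auto
    qed
    ultimately have k_eq: "k = n - 2" using en n4 k(1) by presburger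
    have y0: "b (n - 2) = y0" using k k_eq by simp
    have Ra3: "R (a 3) (b j)" if "j < n" "odd j" "j \<ge> 3" for j
      using rules(3)[of j 3] W[of j] W[of 3] zigzagD(3)[OF z, of 3] that n4 by (cases "j = 3") auto
    have Ra32: "R (a 3) (b 2)" using zigzagD(4)[OF z, of 2] n4 by (simp add: numeral_3_eq_3)
    have Ra31: "\<not> R (a 3) (b 1)" using rules(4)[of 1 3] W[of 1] W[of 2] n4 by simp
    have Ra01: "\<not> R (a 0) (b 1)" using W[of 1] n4 by (simp add: W_def)
    \<comment> \<open>\<open>b 1\<close> is a common non-neighbour of \<open>a 0\<close> and
      \<open>a 3\<close>, which makes the degree hypothesis applicable.\<close>
    have deg_eq: "card {y \<in> Y. R (a 0) y} = card {y \<in> Y. R (a 3) y}"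
      by (rule deg[OF a_in a_in b_in Ra01 Ra31]) (use n4 in auto)
    have idx: "card {y \<in> Y. P y} = card {j. j < n \<and> P (b j)}" for P
      using card_filter_bij[OF b] by simp
    text \<open>The even indices are the neighbours of \<open>a 0\<close>; they inject into those of \<open>a 3\<close>, and since
      both degrees agree the image leaves no room for a further even index such as \<open>n - 2\<close>.\<close>
    define f where "f k = (if k = 0 then 2 else Suc k)" for k :: nat
    have sub: "f ` {j. j < n \<and> R (a 0) (b j)} \<subseteq> {j. j < n \<and> R (a 3) (b j)}"
    proof (clarify, intro conjI)
      fix j assume j: "j < n" "R (a 0) (b j)"
      then have "even j" using W[of j] by (simp add: W_def)
      then have "Suc j < n" "j \<noteq> 0 \<Longrightarrow> Suc j \<ge> 3" using j en by presburger+
      then show "f j < n" "R (a 3) (b (f j))"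
        using Ra3[of "Suc j"] Ra32 \<open>even j\<close> n4 by (auto simp: f_def)
    qed
    have "inj_on f {j. j < n \<and> R (a 0) (b j)}"
      using W by (auto simp: inj_on_def f_def W_def[symmetric])
    then have "card (f ` {j. j < n \<and> R (a 0) (b j)}) = card {j. j < n \<and> R (a 0) (b j)}"
      by (rule card_image)
    then have "card (f ` {j. j < n \<and> R (a 0) (b j)}) = card {j. j < n \<and> R (a 3) (b j)}"
      using deg_eq by (simp add: idx)
    then have img: "f ` {j. j < n \<and> R (a 0) (b j)} = {j. j < n \<and> R (a 3) (b j)}"
      by (intro card_subset_eq sub) auto
    have even_nbr: "j = 2" if "j < n" "even j" "R (a 3) (b j)" for j
    proof -
      have "j \<in> f ` {j. j < n \<and> R (a 0) (b j)}" using img that by auto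
      then show ?thesis using W that by (auto simp: f_def W_def[symmetric] split: if_splits)
    qed
    have "n - 2 = 2" using even_nbr[of "n - 2"] full(2)[OF a_in[of 3]] y0 en n4 by auto
    then have n_eq: "n = 4" using n4 by simp
    have less4: "(\<forall>k<4. P k) \<longleftrightarrow> P 0 \<and> P 1 \<and> P 2 \<and> P 3" for P :: "nat \<Rightarrow> bool"
      by (auto simp: numeral_eq_Suc less_Suc_eq)
    have WW: "W 0" "\<not> W 1" "W 2" "\<not> W 3" using W n_eq by auto
    have y0': "R (a k) (b 2)" if "k < 4" for k using full(2)[OF a_in] y0 n_eq that by auto
    have "\<not> R (a 3) (b 0)" using even_nbr[of 0] n_eq by auto
    moreover have "R (a 0) (b 0)" "R (a 0) (b 2)" "\<not> R (a 0) (b 1)" "\<not> R (a 0) (b 3)"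
      using WW by (auto simp: W_def)
    moreover have "R (a 1) (b 0)" "R (a 1) (b 1)" "R (a 1) (b 2)" "R (a 1) (b 3)"
      using zigzagD(4)[OF z, of 0] zigzagD(3)[OF z, of 1] y0'[of 1] rules(3)[of 3 1] WW n_eq by auto
    moreover have "\<not> R (a 2) (b 0)" "R (a 2) (b 1)" "R (a 2) (b 2)" "\<not> R (a 2) (b 3)"
      using rules(2)[of 2 0] zigzagD(4)[OF z, of 1] y0'[of 2] rules(1)[of 2 3] WW n_eq
      by (auto simp: numeral_2_eq_2)
    moreover have "\<not> R (a 3) (b 1)" "R (a 3) (b 2)" "R (a 3) (b 3)"
      using Ra31 y0'[of 3] zigzagD(3)[OF z, of 3] n_eq by auto
    ultimately have "\<forall>k<4. \<forall>j<4. R (a k) (b j) \<longleftrightarrow>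
      (k, j) \<in> {(0,0),(0,2),(1,0),(1,1),(1,2),(1,3),(2,1),(2,2),(3,2),(3,3)}"
      unfolding less4 by simp
    then show ?thesis using n_eq y0 by auto
  qed
qed

section \<open>Hamilton cycles and how to cut them\<close>

lemma hamiltonian_mono:
  assumes "hamiltonian n R X Y" and n: "n \<ge> 1"
    and R: "\<And>x y. x \<in> X \<Longrightarrow> y \<in> Y \<Longrightarrow> R x y \<Longrightarrow> R' x y"
  shows "hamiltonian n R' X Y"
proof -
  obtain a b where z: "zigzag n R X Y a b" and c: "R (a 0) (b (n - 1))"
    using assms(1) by (auto simp: hamiltonian_def)
  have "a k \<in> X" "b k \<in> Y" if "k < n" for k using z that by (auto simp: zigzag_def bij_betw_def)
  then have "zigzag n R' X Y a b" "R' (a 0) (b (n - 1))"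
    using z c n R by (auto simp: zigzag_def)
  then show ?thesis by (auto simp: hamiltonian_def)
qed

text \<open>Renumbers a cycle to start at \<open>a p\<close>. The edge entering \<open>a p\<close>
  is the place of the cut, so it alone may be missing.\<close>

lemma zigzag_shift:
  assumes a: "bij_betw a {..<n} X" and b: "bij_betw b {..<n} Y" and p: "p < n"
    and 1: "\<And>i. i < n \<Longrightarrow> R (a i) (b i)"
    and 2: "\<And>i. i < n \<Longrightarrow> Suc i mod n \<noteq> p \<Longrightarrow> R (a (Suc i mod n)) (b i)"
  shows "zigzag n R X Y (\<lambda>k. a ((p + k) mod n)) (\<lambda>k. b ((p + k) mod n))"
proof -
  have mod_inv: "(n - p + (p + k) mod n) mod n = k" "(p + (n - p + k) mod n) mod n = k" if "k < n" for k
    unfolding mod_add_right_eq using that p by simp_all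
  have bij: "bij_betw (\<lambda>k. (p + k) mod n) {..<n} {..<n}"
    by (rule bij_betw_byWitness[where f' = "\<lambda>k. (n - p + k) mod n"]) (use p mod_inv in auto)
  have "R (a ((p + Suc k) mod n)) (b ((p + k) mod n))" if k: "Suc k < n" for k
  proof -
    have "Suc ((p + k) mod n) mod n = (p + Suc k) mod n" by (simp add: mod_Suc_eq)
    moreover have "(p + Suc k) mod n \<noteq> p"
    proof
      assume "(p + Suc k) mod n = p"
      then have "(p + Suc k) mod n = (p + 0) mod n" using p by simp
      then have "Suc k = 0" using mod_inv(1)[OF k] mod_inv(1)[of 0] p by auto
      then show False by simp
    qed
    ultimately show ?thesis using 2[of "(p + k) mod n"] p by simp
  qed
  then show ?thesis
    using bij_betw_trans[OF bij a] bij_betw_trans[OF bij b] 1 p by (auto simp: zigzag_def o_def)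
qed

lemma closed_zigzag:
  assumes z: "zigzag n R X Y a b" and c: "R (a 0) (b (n - 1))" and i: "i < n"
  shows "R (a (Suc i mod n)) (b i)"
  using zigzagD(4)[OF z] c i by (cases "Suc i = n") auto

text \<open>A Hamilton cycle of the enlarged relation must use the new pair, since \<open>R\<close>
  itself has none; cutting the cycle at that pair leaves the required path.\<close>

lemma zigzag_between_critical_nonadjacent:
  assumes n: "n \<ge> 2" and nonham: "\<not> hamiltonian n R X Y" and xy: "x \<in> X" "y \<in> Y"
    and ham: "hamiltonian n (\<lambda>u v. R u v \<or> (u = x \<and> v = y)) X Y" (is "hamiltonian n ?R X Y")
  shows "\<exists>a b. zigzag n R X Y a b \<and> a 0 = x \<and> b (n - 1) = y"
proof -
  obtain a b where z: "zigzag n ?R X Y a b" and c: "?R (a 0) (b (n - 1))"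
    using ham unfolding hamiltonian_def by blast
  have a: "bij_betw a {..<n} X" and b: "bij_betw b {..<n} Y" using z by (auto simp: zigzag_def)
  obtain p q where p: "p < n" "x = a p" and q: "q < n" "y = b q"
    using a b xy by (auto simp: bij_betw_def)
  have inj: "a i = x \<longleftrightarrow> i = p" "b i = y \<longleftrightarrow> i = q" if "i < n" for i
    using that p q a b by (auto simp: bij_betw_def dest: inj_onD)
  have 1: "R (a i) (b i)" if "i < n" "\<not> (i = p \<and> i = q)" for i
    using zigzagD(3)[OF z that(1)] inj[OF that(1)] that by auto
  have 2: "R (a (Suc i mod n)) (b i)" if "i < n" "\<not> (Suc i mod n = p \<and> i = q)" for i
  proof -
    have "Suc i mod n < n" using that by simp
    then show ?thesis using closed_zigzag[OF z c that(1)] inj(1) inj(2)[OF that(1)] that by auto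
  qed
  have succ: "Suc i mod n \<noteq> i" if "i < n" for i
    using n that by (cases "Suc i = n") auto
  have last: "Suc ((p + (n - 1)) mod n) mod n = p"
    using p n by (simp add: mod_Suc_eq)
  \<comment> \<open>The cycle traverses the pair from \<open>x\<close> to \<open>y\<close>, from
    \<open>y\<close> to \<open>x\<close>, or not at all. By \<open>succ\<close> the first two cases
    exclude each other, so every other edge of the cycle lies in \<open>R\<close>.\<close>
  consider "p = q" | "p = Suc q mod n" | "p \<noteq> q" "p \<noteq> Suc q mod n" by blast
  then show ?thesis
  proof cases
    case 1
    have suc: "bij_betw (\<lambda>k. (1 + k) mod n) {..<n} {..<n}"
      using zigzag_shift[of id n "{..<n}" id "{..<n}" 1 "\<lambda>_ _. True"] n by (simp add: zigzag_def)
    \<comment> \<open>Cut between \<open>a p\<close> and \<open>b p\<close>, the cycle becomes a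
      path from \<open>y\<close> to \<open>x\<close>; it is written with the sides exchanged and
      reversed afterwards.\<close>
    have "zigzag n (\<lambda>y x. R x y) Y X (\<lambda>k. b ((p + k) mod n))
        (\<lambda>k. (\<lambda>k. a (Suc k mod n)) ((p + k) mod n))"
    proof (rule zigzag_shift[OF b _ p(1)])
      show "bij_betw (\<lambda>k. a (Suc k mod n)) {..<n} X"
        using bij_betw_trans[OF suc a] by (simp add: o_def)
      show "R (a (Suc i mod n)) (b i)" if "i < n" for i
        using 2[OF that] succ[OF that] \<open>p = q\<close> by auto
      show "R (a (Suc i mod n)) (b (Suc i mod n))" if "i < n" "Suc i mod n \<noteq> p" for i
        using \<open>\<And>i. i < n \<Longrightarrow> \<not> (i = p \<and> i = q) \<Longrightarrow> R (a i) (b i)\<close>[of "Suc i mod n"] that by auto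
    qed
    from zigzag_reverse[OF this] show ?thesis
      using last p q \<open>p = q\<close> by (intro exI conjI) (assumption, auto)
  next
    case 2
    have "zigzag n R X Y (\<lambda>k. a ((p + k) mod n)) (\<lambda>k. b ((p + k) mod n))"
    proof (rule zigzag_shift[OF a b p(1)])
      show "R (a i) (b i)" if "i < n" for i
        using 1[OF that] succ[OF q(1)] 2 by auto
      show "R (a (Suc i mod n)) (b i)" if "i < n" "Suc i mod n \<noteq> p" for i
        using \<open>\<And>i. i < n \<Longrightarrow> \<not> (Suc i mod n = p \<and> i = q) \<Longrightarrow> R (a (Suc i mod n)) (b i)\<close>[of i] that
        by auto
    qed
    moreover have "(p + (n - 1)) mod n = q"
    proof (cases "Suc q = n")
      case True
      then show ?thesis using 2 n by auto
    next
      case False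
      then have "p = Suc q" using 2 q by simp
      then have "p + (n - 1) = q + n" using n by simp
      then show ?thesis using q by simp
    qed
    ultimately show ?thesis using p q by (intro exI conjI) (assumption, auto)
  next
    case 3
    have "zigzag n R X Y (\<lambda>k. a ((0 + k) mod n)) (\<lambda>k. b ((0 + k) mod n))"
      using 1 2 3 n by (intro zigzag_shift[OF a b]) auto
    moreover have "R (a 0) (b (n - 1))" using 2[of "n - 1"] 3 n by (cases "q = n - 1") auto
    ultimately have "hamiltonian n R X Y" unfolding hamiltonian_def
      by (intro exI conjI) (assumption, use n in auto)
    with nonham show ?thesis by contradiction
  qed
qed

lemma hamiltonian_complete:
  assumes n: "n \<ge> 1" and "finite X" "finite Y" "card X = n" "card Y = n"
    and R: "\<And>x y. x \<in> X \<Longrightarrow> y \<in> Y \<Longrightarrow> R x y"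
  shows "hamiltonian n R X Y"
proof -
  obtain a b where a: "bij_betw a {..<n} X" and b: "bij_betw b {..<n} Y"
    using assms ex_bij_betw_nat_finite by (metis lessThan_atLeast0)
  then have "a i \<in> X" "b i \<in> Y" if "i < n" for i using that by (auto simp: bij_betw_def)
  then have "zigzag n R X Y a b" "R (a 0) (b (n - 1))"
    using a b R n by (auto simp: zigzag_def)
  then show ?thesis by (auto simp: hamiltonian_def)
qed

text \<open>The Rayleigh bound is tested on the degree function of the subgraph \<open>H\<close>.\<close>

lemma edge_degree_sum_extremal:
  fixes P Q :: "'a set" and F H :: "'a \<Rightarrow> 'a \<Rightarrow> bool" and n :: nat
  defines "dP \<equiv> \<lambda>x. card {y \<in> Q. H x y}" and "dQ \<equiv> \<lambda>y. card {x \<in> P. H x y}"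
  assumes fin: "finite P" "finite Q" and dis: "P \<inter> Q = {}"
    and bound: "\<And>f :: 'a \<Rightarrow> real. (\<Sum>x\<in>P. \<Sum>y\<in>Q. if F x y then (f x + f y)\<^sup>2 else 0)
      \<le> real n * (\<Sum>v\<in>P \<union> Q. (f v)\<^sup>2)"
    and sub: "\<And>x y. x \<in> P \<Longrightarrow> y \<in> Q \<Longrightarrow> H x y \<Longrightarrow> F x y"
    and ge: "\<And>x y. x \<in> P \<Longrightarrow> y \<in> Q \<Longrightarrow> H x y \<Longrightarrow> n \<le> dP x + dQ y"
    and xy: "x \<in> P" "y \<in> Q" "F x y"
  shows "if H x y then dP x + dQ y = n else dP x = 0 \<and> dQ y = 0"
proof -
  define f where "f v = real (if v \<in> P then dP v else dQ v)" for v
  \<comment> \<open>With \<open>s = f x + f y\<close> the term is \<open>s * (s - n)\<close> on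
    pairs of \<open>H\<close>, \<open>s * s\<close> on the other pairs of \<open>F\<close>, and 0
    elsewhere. All terms are nonnegative and their sum is at most 0, so each vanishes.\<close>
  define t where "t x y = (if F x y then (f x + f y)\<^sup>2 else 0) - (if H x y then n * (f x + f y) else 0)"
    for x y
  have fP: "f x = dP x" if "x \<in> P" for x using that by (simp add: f_def)
  have fQ: "f y = dQ y" if "y \<in> Q" for y using that dis by (auto simp: f_def)
  \<comment> \<open>Double counting: the squared degrees add up to the sum of
    \<open>f x + f y\<close> over the edges of \<open>H\<close>.\<close>
  have "(\<Sum>x\<in>P. (f x)\<^sup>2) = (\<Sum>x\<in>P. \<Sum>y\<in>Q. if H x y then f x else 0)"
    using fin by (intro sum.cong refl)
      (auto simp: fP dP_def power2_eq_square sum.If_cases Int_def conj_commute)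
  moreover have "(\<Sum>y\<in>Q. (f y)\<^sup>2) = (\<Sum>y\<in>Q. \<Sum>x\<in>P. if H x y then f y else 0)"
    using fin by (intro sum.cong refl)
      (auto simp: fQ dQ_def power2_eq_square sum.If_cases Int_def conj_commute)
  moreover have "(\<Sum>y\<in>Q. \<Sum>x\<in>P. if H x y then f y else 0) = (\<Sum>x\<in>P. \<Sum>y\<in>Q. if H x y then f y else 0)"
    by (rule sum.swap)
  moreover have "(\<Sum>v\<in>P \<union> Q. (f v)\<^sup>2) = (\<Sum>x\<in>P. (f x)\<^sup>2) + (\<Sum>y\<in>Q. (f y)\<^sup>2)"
    using fin dis by (rule sum.union_disjoint)
  ultimately have total: "(\<Sum>v\<in>P \<union> Q. (f v)\<^sup>2) = (\<Sum>x\<in>P. \<Sum>y\<in>Q. if H x y then f x + f y else 0)"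
    by (simp add: sum.distrib[symmetric] if_distrib cong: if_cong)
  have "n * (\<Sum>v\<in>P \<union> Q. (f v)\<^sup>2) = (\<Sum>x\<in>P. \<Sum>y\<in>Q. if H x y then n * (f x + f y) else 0)"
    unfolding total sum_distrib_left by (intro sum.cong refl) auto
  then have le0: "(\<Sum>x\<in>P. \<Sum>y\<in>Q. t x y) \<le> 0"
    using bound[of f] by (simp add: t_def sum_subtractf)
  have sge: "real n \<le> f x + f y" if "x \<in> P" "y \<in> Q" "H x y" for x y
    using ge[OF that] fP[OF that(1)] fQ[OF that(2)] by linarith
  have t0: "t x y \<ge> 0" if "x \<in> P" "y \<in> Q" for x y
  proof (cases "H x y")
    case True
    have "n * (f x + f y) \<le> (f x + f y) * (f x + f y)"
      by (intro mult_right_mono sge that True) (simp add: f_def)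
    then show ?thesis using sub[OF that True] True by (simp add: t_def power2_eq_square)
  qed (simp add: t_def)
  have "(\<Sum>x\<in>P. \<Sum>y\<in>Q. t x y) = 0"
    using le0 t0 by (intro antisym sum_nonneg) auto
  then have "t x y = 0"
    using t0 fin xy by (simp add: sum_nonneg_eq_0_iff sum_nonneg)
  show ?thesis
  proof (cases "H x y")
    case True
    then have "dP x > 0" unfolding dP_def using fin xy by (auto simp: card_gt_0_iff)
    then have "f x + f y > 0" using fP[OF xy(1)] fQ[OF xy(2)] by linarith
    moreover have "(f x + f y) * (f x + f y - n) = 0"
      using \<open>t x y = 0\<close> True xy by (simp add: t_def power2_eq_square algebra_simps)
    ultimately have "f x + f y = n" by simp
    then show ?thesis using True fP[OF xy(1)] fQ[OF xy(2)] by (simp flip: of_nat_add)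
  next
    case False
    then have "f x + f y = 0" using \<open>t x y = 0\<close> xy by (simp add: t_def)
    then show ?thesis using False fP[OF xy(1)] fQ[OF xy(2)] by simp
  qed
qed

text \<open>The extra vertex \<open>None\<close> is joined to all of the larger part, so that Hamilton paths of the
  nearly balanced graph become Hamilton cycles of a balanced one.\<close>

definition cone :: "('a \<Rightarrow> 'b \<Rightarrow> bool) \<Rightarrow> 'a \<Rightarrow> 'b option \<Rightarrow> bool" where
  "cone E x z = (case z of None \<Rightarrow> True | Some y \<Rightarrow> E x y)"

lemma cone_simps [simp]: "cone E x None" "cone E x (Some y) = E x y"
  by (simp_all add: cone_def)

section \<open>Structure of nonhamiltonian cones under the spectral bound\<close>

text \<open>Crossover: rotating along the first chord puts \<open>a i\<close> in front and keeps the
  end, so the second chord would close a Hamilton cycle.\<close>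

lemma nonhamiltonian_no_crossing:
  assumes nonham: "\<not> hamiltonian n R X Y" and z: "zigzag n R X Y a b" and i: "i < n"
  shows "\<not> R (a 0) (b i) \<or> \<not> R (a i) (b (n - 1))"
proof (rule ccontr)
  assume "\<not> ?thesis"
  then have R: "R (a 0) (b i)" "R (a i) (b (n - 1))" by auto
  have "\<not> n - 1 < i" using i by simp
  with R(2) have "R ((\<lambda>k. if k \<le> i then a (i - k) else a k) 0)
      ((\<lambda>k. if k < i then b (i - 1 - k) else b k) (n - 1))" by simp
  with zigzag_rotate[OF z i R(1)] have "hamiltonian n R X Y"
    unfolding hamiltonian_def by (intro exI conjI)
  with nonham show False by contradiction
qed

text \<open>The maximal supergraph is a set \<open>M\<close> of pairs from
  \<open>P \<times> Q\<close>, so \<open>None\<close> stays full by the definition of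
  \<open>cone\<close>. The structure found for \<open>M\<close> is carried back to \<open>E\<close>
  through the extremal degree conditions \<open>ext\<close>.\<close>

lemma nontraceable_structure:
  fixes P Q :: "'a set" and E :: "'a \<Rightarrow> 'a \<Rightarrow> bool"
  assumes fin: "finite P" "finite Q" and dis: "P \<inter> Q = {}"
    and cP: "card P = n" and cQ: "Suc (card Q) = n"
    and bound: "\<And>f :: 'a \<Rightarrow> real. (\<Sum>x\<in>P. \<Sum>y\<in>Q. if \<not> E x y then (f x + f y)\<^sup>2 else 0)
      \<le> real n * (\<Sum>v\<in>P \<union> Q. (f v)\<^sup>2)"
    and nonham: "\<not> hamiltonian n (cone E) P (insert None (Some ` Q))"
  shows "(\<exists>A\<subseteq>P. \<exists>B\<subseteq>Q. A \<noteq> {} \<and> B \<noteq> {} \<and> card A + card B = n \<and>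
      (\<forall>x\<in>A. \<forall>y\<in>Q. E x y \<longleftrightarrow> y \<notin> B) \<and> (\<forall>y\<in>B. \<forall>x\<in>P. E x y \<longleftrightarrow> x \<notin> A)) \<or>
    (n = 4 \<and> (\<exists>a c. bij_betw a {..<4} P \<and> bij_betw c {..<3} Q \<and>
      (\<forall>k<4. \<forall>j<3. E (a k) (c j) \<longleftrightarrow> k = 1 \<or> (k, j) \<in> {(0::nat, 0::nat), (2, 1), (3, 2)})))"
proof -
  define Y where "Y = insert None (Some ` Q)"
  have finY: "finite Y" using fin by (simp add: Y_def)
  have cY: "card Y = n" unfolding Y_def using fin cQ by (subst card_insert_disjoint) (auto simp: card_image)
  have n1: "n \<ge> 1" using cQ by simp
  define S where "S = {M. M \<subseteq> P \<times> Q \<and> {(x, y) \<in> P \<times> Q. E x y} \<subseteq> M \<and>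
    \<not> hamiltonian n (cone (\<lambda>x y. (x, y) \<in> M)) P Y}"
  have "\<not> hamiltonian n (cone (\<lambda>x y. (x, y) \<in> {(x, y) \<in> P \<times> Q. E x y})) P Y"
    using nonham n1 unfolding Y_def[symmetric]
    by (auto dest!: hamiltonian_mono[where R' = "cone E"] simp: cone_def split: option.splits)
  then have "{(x, y) \<in> P \<times> Q. E x y} \<in> S" by (auto simp: S_def)
  moreover have "finite S"
    by (rule finite_subset[of _ "Pow (P \<times> Q)"]) (use fin in \<open>auto simp: S_def\<close>)
  ultimately obtain M where M: "M \<in> S" and Mmax: "\<And>N. N \<in> S \<Longrightarrow> M \<subseteq> N \<Longrightarrow> M = N"
    using finite_has_maximal[of S] by blast
  define R where "R = cone (\<lambda>x y. (x, y) \<in> M)"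
  have MPQ: "M \<subseteq> P \<times> Q" and EM: "\<And>x y. x \<in> P \<Longrightarrow> y \<in> Q \<Longrightarrow> E x y \<Longrightarrow> (x, y) \<in> M"
    and nonhamR: "\<not> hamiltonian n R P Y"
    using M by (auto simp: S_def R_def)
  have Rsimps [simp]: "R x None" "R x (Some y) \<longleftrightarrow> (x, y) \<in> M" for x y
    by (simp_all add: R_def)
  define dP where "dP x = card {y \<in> Q. (x, y) \<notin> M}" for x
  define dQ where "dQ y = card {x \<in> P. (x, y) \<notin> M}" for y
  have dP_Y: "card {z \<in> Y. \<not> R x z} = dP x" for x
  proof -
    have "{z \<in> Y. \<not> R x z} = Some ` {y \<in> Q. (x, y) \<notin> M}" by (auto simp: Y_def)
    then show ?thesis by (simp add: dP_def card_image)
  qed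
  have zig: "\<exists>a b. zigzag n R P Y a b \<and> a 0 = x \<and> b (n - 1) = Some y"
    if xy: "x \<in> P" "y \<in> Q" "(x, y) \<notin> M" for x y
  proof (rule zigzag_between_critical_nonadjacent[OF _ nonhamR])
    have "card Q > 0" using xy fin by (auto simp: card_gt_0_iff)
    then show "n \<ge> 2" using cQ by simp
    have "insert (x, y) M \<notin> S" using Mmax[of "insert (x, y) M"] xy by blast
    then have "hamiltonian n (cone (\<lambda>u v. (u, v) \<in> insert (x, y) M)) P Y"
      using xy MPQ EM by (auto simp: S_def)
    then show "hamiltonian n (\<lambda>u v. R u v \<or> u = x \<and> v = Some y) P Y"
      using n1 by (rule hamiltonian_mono) (auto simp: cone_def R_def split: option.splits)
  qed (use xy in \<open>auto simp: Y_def\<close>)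
  \<comment> \<open>The degrees of the two ends in the complement of \<open>M\<close>, read off as
    index sets along the path. Since no index carries both crossing chords, these sets cover all
    indices, which gives the lower bound \<open>ge\<close>.\<close>
  have index: "dP (a 0) = card {i \<in> {..<n}. \<not> R (a 0) (b i)}"
      "dQ y = card {i \<in> {..<n}. \<not> R (a i) (b (n - 1))}"
      "{i \<in> {..<n}. \<not> R (a 0) (b i)} \<union> {i \<in> {..<n}. \<not> R (a i) (b (n - 1))} = {..<n}"
    if z: "zigzag n R P Y a b" and b: "b (n - 1) = Some y" for a b y
  proof -
    show "dP (a 0) = card {i \<in> {..<n}. \<not> R (a 0) (b i)}"
      unfolding dP_Y[symmetric] by (rule card_filter_bij[OF zigzagD(2)[OF z]])
    show "dQ y = card {i \<in> {..<n}. \<not> R (a i) (b (n - 1))}"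
      unfolding dQ_def b Rsimps by (rule card_filter_bij[OF zigzagD(1)[OF z]])
    show "{i \<in> {..<n}. \<not> R (a 0) (b i)} \<union> {i \<in> {..<n}. \<not> R (a i) (b (n - 1))} = {..<n}"
      using nonhamiltonian_no_crossing[OF nonhamR z] by blast
  qed
  have ge: "n \<le> dP x + dQ y" if xy: "x \<in> P" "y \<in> Q" "(x, y) \<notin> M" for x y
  proof -
    obtain a b where z: "zigzag n R P Y a b" "a 0 = x" "b (n - 1) = Some y"
      using zig[OF xy] by blast
    have "n \<le> dP (a 0) + dQ y"
      using card_Un_le[of "{i \<in> {..<n}. \<not> R (a 0) (b i)}" "{i \<in> {..<n}. \<not> R (a i) (b (n - 1))}"]
      unfolding index(3)[OF z(1,3)] index(1,2)[OF z(1,3), symmetric] by simp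
    then show ?thesis by (simp add: z(2))
  qed
  have ext: "if (x, y) \<notin> M then dP x + dQ y = n else dP x = 0 \<and> dQ y = 0"
    if "x \<in> P" "y \<in> Q" "\<not> E x y" for x y
    unfolding dP_def dQ_def
    by (rule edge_degree_sum_extremal[OF fin dis bound, where H = "\<lambda>x y. (x, y) \<notin> M"])
      (use that EM ge in \<open>auto simp: dP_def dQ_def\<close>)
  have deg_sum: "dP x + dQ y = n" if "x \<in> P" "y \<in> Q" "(x, y) \<notin> M" for x y
    using ext[of x y] EM that by auto
  have tight: "tight n R P Y"
    unfolding tight_def
  proof (intro allI impI)
    fix a b i assume z: "zigzag n R P Y a b" and i: "i < n"
    have "\<not> R (a 0) (b (n - 1))" using nonhamR z by (auto simp: hamiltonian_def)
    then obtain y where y: "b (n - 1) = Some y" "(a 0, y) \<notin> M" by (cases "b (n - 1)") auto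
    have "a 0 \<in> P" "b (n - 1) \<in> Y" using z n1 by (auto simp: zigzag_def bij_betw_def)
    with y have sum: "dP (a 0) + dQ y = n" by (intro deg_sum) (auto simp: Y_def)
    let ?I = "{i \<in> {..<n}. \<not> R (a 0) (b i)}" and ?J = "{i \<in> {..<n}. \<not> R (a i) (b (n - 1))}"
    \<comment> \<open>The degree sum is now exactly \<open>n\<close>, so the two covering index sets
      must be disjoint: each index carries exactly one chord.\<close>
    have "card ?I + card ?J = card (?I \<union> ?J) + card (?I \<inter> ?J)"
      by (rule card_Un_Int) auto
    then have "card (?I \<inter> ?J) = 0"
      unfolding index(3)[OF z y(1)] index(1,2)[OF z y(1), symmetric] using sum by simp
    then have "?I \<inter> ?J = {}" by simp
    then show "R (a 0) (b i) \<longleftrightarrow> \<not> R (a i) (b (n - 1))"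
      using i nonhamiltonian_no_crossing[OF nonhamR z i] by blast
  qed
  have "\<exists>x\<in>P. \<exists>y\<in>Y. \<not> R x y"
    using hamiltonian_complete[OF n1 fin(1) finY cP cY, of R] nonhamR by blast
  then obtain x y where "x \<in> P" "y \<in> Q" "(x, y) \<notin> M" by (auto simp: Y_def)
  then obtain a b where z: "zigzag n R P Y a b" using zig by blast
  have deg': "card {z \<in> Y. R x z} = card {z \<in> Y. R x' z}"
    if x: "x \<in> P" "x' \<in> P" and z: "z \<in> Y" "\<not> R x z" "\<not> R x' z" for x x' z
  proof -
    obtain y where y: "z = Some y" "y \<in> Q" using z by (auto simp: Y_def)
    have "dP x = dP x'" using deg_sum[of x y] deg_sum[of x' y] x y z by auto
    moreover have "card {z \<in> Y. R x z} = n - dP x" for x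
    proof -
      have "{z \<in> Y. R x z} = Y - {z \<in> Y. \<not> R x z}" by auto
      then show ?thesis unfolding dP_Y[symmetric] cY[symmetric]
        using card_Diff_subset[of "{z \<in> Y. \<not> R x z}" Y] finY by auto
    qed
    ultimately show ?thesis by simp
  qed
  have deg: "\<forall>x\<in>P. \<forall>x'\<in>P. \<forall>z\<in>Y. \<not> R x z \<longrightarrow> \<not> R x' z \<longrightarrow>
      card {z \<in> Y. R x z} = card {z \<in> Y. R x' z}"
    using deg' by blast
  have None: "None \<in> Y" "\<forall>x\<in>P. R x None" by (simp_all add: Y_def)
  from tight_structure[OF tight z n1 None deg] show ?thesis
  proof (elim disjE)
    assume "\<exists>A\<subseteq>P. \<exists>B\<subseteq>Y. A \<noteq> {} \<and> B \<noteq> {} \<and> card A + card B = n \<and>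
      (\<forall>x\<in>A. \<forall>y\<in>Y. R x y \<longleftrightarrow> y \<notin> B) \<and> (\<forall>y\<in>B. \<forall>x\<in>P. R x y \<longleftrightarrow> x \<notin> A)"
    then obtain A B where join: "A \<subseteq> P" "B \<subseteq> Y" "A \<noteq> {}" "B \<noteq> {}" "card A + card B = n"
      "\<forall>x\<in>A. \<forall>y\<in>Y. R x y \<longleftrightarrow> y \<notin> B" "\<forall>y\<in>B. \<forall>x\<in>P. R x y \<longleftrightarrow> x \<notin> A"
      by blast
    define B' where "B' = {y. Some y \<in> B}"
    have "None \<notin> B" using join(1,3,6) None by blast
    then have B: "B = Some ` B'"
    proof -
      have "z \<in> Some ` B'" if "z \<in> B" for z
        using that \<open>None \<notin> B\<close> by (cases z) (auto simp: B'_def)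
      then show ?thesis by (auto simp: B'_def)
    qed
    have BQ: "B' \<subseteq> Q" using join(2) by (auto simp: B Y_def)
    \<comment> \<open>By \<open>ext\<close> a pair added to \<open>E\<close> has complement degree 0
      at both ends, so \<open>E\<close> and \<open>M\<close> agree at every vertex of positive
      complement degree.\<close>
    have EM': "E x y \<longleftrightarrow> (x, y) \<in> M" if "x \<in> P" "y \<in> Q" "dP x > 0 \<or> dQ y > 0" for x y
      using ext[OF that(1,2)] EM[OF that(1,2)] that(3) by (cases "E x y") auto
    obtain x0 y0 where x0: "x0 \<in> A" and y0: "y0 \<in> B'" using join(3,4) B by auto
    have MA: "(x, y) \<in> M \<longleftrightarrow> y \<notin> B'" if "x \<in> A" "y \<in> Q" for x y
      using join(6) that by (auto simp: B Y_def)
    have MB: "(x, y) \<in> M \<longleftrightarrow> x \<notin> A" if "x \<in> P" "y \<in> B'" for x y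
      using join(7) that by (auto simp: B)
    have "dP x > 0" if "x \<in> A" for x
      using MA[OF that, of y0] y0 BQ fin unfolding dP_def by (auto simp: card_gt_0_iff)
    then have "\<forall>x\<in>A. \<forall>y\<in>Q. E x y \<longleftrightarrow> y \<notin> B'" using MA EM' join(1) by blast
    moreover have "dQ y > 0" if "y \<in> B'" for y
      using MB[OF _ that, of x0] x0 join(1) fin unfolding dQ_def by (auto simp: card_gt_0_iff)
    then have "\<forall>y\<in>B'. \<forall>x\<in>P. E x y \<longleftrightarrow> x \<notin> A" using MB EM' BQ by blast
    moreover have "card B = card B'" unfolding B by (simp add: card_image)
    moreover have "B' \<noteq> {}" using y0 by blast
    ultimately show ?thesis
      using join(1,3,5) BQ by (intro disjI1 exI[of _ A] exI[of _ B'] conjI) simp_all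
  next
    assume *: "n = 4 \<and> None = b 2 \<and> (\<forall>k<4. \<forall>j<4. R (a k) (b j) \<longleftrightarrow>
      (k, j) \<in> {(0,0),(0,2),(1,0),(1,1),(1,2),(1,3),(2,1),(2,2),(3,2),(3,3)})"
    have tree: "n = 4" "b 2 = None" "\<forall>k<4. \<forall>j<4. R (a k) (b j) \<longleftrightarrow>
      (k, j) \<in> {(0,0),(0,2),(1,0),(1,1),(1,2),(1,3),(2,1),(2,2),(3,2),(3,3)}"
      using *[THEN conjunct1] *[THEN conjunct2, THEN conjunct1] *[THEN conjunct2, THEN conjunct2]
      by simp_all
    \<comment> \<open>Skips index 2, the position of \<open>None\<close>; thus \<open>c\<close>
      lists \<open>Q\<close> in the order of \<open>b 0\<close>, \<open>b 1\<close>,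
      \<open>b 3\<close>.\<close>
    define s where "s j = (if j = 2 then 3 else j)" for j :: nat
    define c where "c j = the (b (s j))" for j
    have a: "bij_betw a {..<4} P" and b: "bij_betw b {..<4} Y"
      using z tree(1) by (auto simp: zigzag_def)
    have s: "s j < 4" "s j \<noteq> 2" if "j < 3" for j using that by (auto simp: s_def)
    have bc: "b (s j) = Some (c j)" if "j < 3" for j
    proof -
      have "b (s j) \<noteq> b 2" using s[OF that] b by (auto simp: bij_betw_def dest: inj_onD)
      then show ?thesis using tree(2) by (auto simp: c_def)
    qed
    have cQ': "c j \<in> Q" if "j < 3" for j
    proof -
      have "b (s j) \<in> Y" using b s[OF that] by (auto simp: bij_betw_def)
      then show ?thesis using bc[OF that] by (auto simp: Y_def)
    qed
    have "y \<in> c ` {..<3}" if "y \<in> Q" for y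
    proof -
      have "Some y \<in> b ` {..<4}" using b that by (auto simp: bij_betw_def Y_def)
      then obtain j where j: "j < 4" "b j = Some y" by auto
      have "j \<noteq> 2" using j tree(2) by auto
      with j(1) have "s (if j = 3 then 2 else j) = j" "(if j = 3 then 2 else j) < 3"
        by (auto simp: s_def)
      then show ?thesis using j(2) bc by (metis imageI lessThan_iff option.inject)
    qed
    with cQ' have Q: "c ` {..<3} = Q" by auto
    moreover have "card Q = 3" using cQ tree(1) by simp
    ultimately have "bij_betw c {..<3} Q"
      by (auto simp: bij_betw_def intro: eq_card_imp_inj_on)
    have M_iff: "(a k, c j) \<in> M \<longleftrightarrow> k = 1 \<or> (k, j) \<in> {(0, 0), (2, 1), (3, 2)}"
      if "k < 4" "j < 3" for k j
    proof -
      have "(a k, c j) \<in> M \<longleftrightarrow> R (a k) (b (s j))" by (simp add: bc that)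
      also have "\<dots> \<longleftrightarrow> (k, s j) \<in> {(0,0),(0,2),(1,0),(1,1),(1,2),(1,3),(2,1),(2,2),(3,2),(3,3)}"
        by (rule tree(3)[THEN spec, THEN mp, OF that(1), THEN spec, THEN mp, OF s(1)[OF that(2)]])
      also have "\<dots> \<longleftrightarrow> k = 1 \<or> (k, j) \<in> {(0, 0), (2, 1), (3, 2)}"
      proof -
        have "k \<in> {0, 1, 2, 3}" "j \<in> {0, 1, 2}" using that by auto
        then show ?thesis by (elim insertE emptyE) (simp_all add: s_def)
      qed
      finally show ?thesis .
    qed
    have aP: "a k \<in> P" if "k < 4" for k using a that by (auto simp: bij_betw_def)
    have dQ_pos: "dQ (c j) > 0" if "j < 3" for j
    proof -
      \<comment> \<open>An index of a vertex missed by \<open>c j\<close>; positive complement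
        degree then transfers the adjacencies from \<open>M\<close> to \<open>E\<close>.\<close>
      define k where "k = (if j = 0 then 2 else 0 :: nat)"
      have "(a k, c j) \<notin> M" "k < 4" using that by (auto simp: k_def M_iff)
      then have "a k \<in> {x \<in> P. (x, c j) \<notin> M}" using aP by simp
      then show ?thesis unfolding dQ_def using fin by (auto simp: card_gt_0_iff)
    qed
    have "E (a k) (c j) \<longleftrightarrow> (a k, c j) \<in> M" if "k < 4" "j < 3" for k j
      using ext[OF aP[OF that(1)] cQ'[OF that(2)]] EM[OF aP[OF that(1)] cQ'[OF that(2)]] dQ_pos[OF that(2)]
      by (cases "E (a k) (c j)") auto
    then have "\<forall>k<4. \<forall>j<3. E (a k) (c j) \<longleftrightarrow> k = 1 \<or> (k, j) \<in> {(0, 0), (2, 1), (3, 2)}"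
      using M_iff by blast
    then show ?thesis
      using tree(1) a \<open>bij_betw c {..<3} Q\<close> by (intro disjI2 conjI exI[of _ a] exI[of _ c])
  qed
qed

section \<open>Bipartite graphs\<close>

lemma adjacent_commute: "adjacent G u v \<longleftrightarrow> adjacent G v u"
  by (simp add: adjacent_def insert_commute)

lemma adjacent_parts:
  assumes "bipartite_graph G" "adjacent G u v"
  shows "u \<in> partX G \<and> v \<in> partY G \<or> u \<in> partY G \<and> v \<in> partX G"
proof -
  obtain x y where "{u, v} = {x, y}" "x \<in> partX G" "y \<in> partY G"
    using assms unfolding bipartite_graph_def adjacent_def by blast
  then show ?thesis by (auto simp: doubleton_eq_iff)
qed

lemma bipartite_graph_quasi_complement:
  "bipartite_graph G \<Longrightarrow> bipartite_graph (quasi_complement G)"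
  by (auto simp: bipartite_graph_def quasi_complement_def)

lemma adjacent_quasi_complement:
  assumes "bipartite_graph G" "x \<in> partX G" "y \<in> partY G"
  shows "adjacent (quasi_complement G) x y \<longleftrightarrow> \<not> adjacent G x y"
proof -
  have "partX G \<inter> partY G = {}" using assms(1) by (simp add: bipartite_graph_def)
  then show ?thesis
    using assms(2,3) by (auto simp: adjacent_def quasi_complement_def doubleton_eq_iff insert_commute)
qed

text \<open>The quadratic form of the signless Laplacian is the sum of
  \<open>(f x + f y)\<^sup>2\<close> over the edges; summing over \<open>partX G\<close> and
  \<open>partY G\<close> counts each edge once.\<close>

lemma edge_form_le_signless_radius:
  fixes f :: "'a \<Rightarrow> real"
  assumes G: "bipartite_graph G" and ne: "verts G \<noteq> {}"
  shows "(\<Sum>x\<in>partX G. \<Sum>y\<in>partY G. if adjacent G x y then (f x + f y)\<^sup>2 else 0)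
    \<le> signless_radius G * (\<Sum>v\<in>verts G. (f v)\<^sup>2)"
proof -
  have fin: "finite (partX G)" "finite (partY G)" and dis: "partX G \<inter> partY G = {}"
    using G by (auto simp: bipartite_graph_def)
  have finV: "finite (verts G)" using fin by (simp add: verts_def)
  define vs where "vs = vertex_list G"
  define N where "N = length vs"
  have "\<exists>vs. distinct vs \<and> set vs = verts G" using finite_distinct_list[OF finV] by blast
  then have vs: "distinct vs" "set vs = verts G"
    unfolding vs_def vertex_list_def by (rule someI_ex[THEN conjunct1], rule someI_ex[THEN conjunct2])
  have bij: "bij_betw (\<lambda>i. vs ! i) {..<N} (verts G)"
    using bij_betw_nth[OF vs(1), of "{..<N}" "verts G"] vs(2) by (simp add: N_def)
  have index: "(\<Sum>i<N. F (vs ! i)) = (\<Sum>v\<in>verts G. F v)" for F :: "'a \<Rightarrow> real"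
    by (rule sum.reindex_bij_betw[OF bij])
  define M where "M u v = (if u = v then real (vdegree G u) else 0) + (if adjacent G u v then 1 else 0)"
    for u v
  let ?A = "signless_laplacian G"
  have A: "?A \<in> carrier_mat N N"
    by (simp add: signless_laplacian_def degree_matrix_def adjacency_matrix_def N_def vs_def)
  have Aij: "?A $$ (i, j) = M (vs ! i) (vs ! j)" if "i < N" "j < N" for i j
    using that vs(1) nth_eq_iff_index_eq[of vs i j]
    by (auto simp: signless_laplacian_def degree_matrix_def adjacency_matrix_def M_def N_def vs_def)
  have N: "N > 0" using ne vs(2) by (auto simp: N_def)
  have deg: "real (vdegree G u) = (\<Sum>v\<in>verts G. if adjacent G u v then 1 else 0)" for u
    using finV by (simp add: vdegree_def sum.If_cases Int_def)
  have X: "(\<Sum>v\<in>verts G. if adjacent G x v then F v else 0)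
      = (\<Sum>y\<in>partY G. if adjacent G x y then F y else 0)"
    if "x \<in> partX G" for x and F :: "'a \<Rightarrow> real"
    by (rule sum.mono_neutral_right[OF finV])
      (use adjacent_parts[OF G] dis that in \<open>auto simp: verts_def\<close>)
  have Y: "(\<Sum>v\<in>verts G. if adjacent G y v then F v else 0)
      = (\<Sum>x\<in>partX G. if adjacent G x y then F x else 0)"
    if "y \<in> partY G" for y and F :: "'a \<Rightarrow> real"
    unfolding adjacent_commute[of G y]
    by (rule sum.mono_neutral_right[OF finV])
      (use adjacent_parts[OF G] dis that in \<open>auto simp: verts_def\<close>)
  have "(\<Sum>i<N. \<Sum>j<N. ?A $$ (i, j) * f (vs ! i) * f (vs ! j))
      = (\<Sum>i<N. \<Sum>j<N. M (vs ! i) (vs ! j) * f (vs ! i) * f (vs ! j))"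
    by (intro sum.cong refl) (simp add: Aij)
  also have "\<dots> = (\<Sum>u\<in>verts G. \<Sum>v\<in>verts G. M u v * f u * f v)"
    unfolding index[of "\<lambda>v. M _ v * f _ * f v"]
    by (rule index[of "\<lambda>u. \<Sum>v\<in>verts G. M u v * f u * f v"])
  \<comment> \<open>The diagonal term of \<open>u\<close> is distributed evenly over the neighbours
    of \<open>u\<close>.\<close>
  also have "\<dots> = (\<Sum>u\<in>verts G. \<Sum>v\<in>verts G. if adjacent G u v then (f u)\<^sup>2 + f u * f v else 0)"
  proof (rule sum.cong[OF refl])
    fix u assume u: "u \<in> verts G"
    have "(\<Sum>v\<in>verts G. M u v * f u * f v)
        = (\<Sum>v\<in>verts G. if u = v then real (vdegree G u) * f u * f v else 0)
          + (\<Sum>v\<in>verts G. if adjacent G u v then f u * f v else 0)"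
      unfolding sum.distrib[symmetric] by (intro sum.cong refl) (simp add: M_def algebra_simps)
    also have "(\<Sum>v\<in>verts G. if u = v then real (vdegree G u) * f u * f v else 0)
        = real (vdegree G u) * (f u)\<^sup>2"
      using finV u by (simp add: power2_eq_square)
    also have "\<dots> = (\<Sum>v\<in>verts G. if adjacent G u v then (f u)\<^sup>2 else 0)"
      unfolding deg sum_distrib_right by (intro sum.cong refl) simp
    finally show "(\<Sum>v\<in>verts G. M u v * f u * f v)
        = (\<Sum>v\<in>verts G. if adjacent G u v then (f u)\<^sup>2 + f u * f v else 0)"
      unfolding sum.distrib[symmetric] by (simp add: if_distrib cong: sum.cong if_cong)
  qed
  \<comment> \<open>Every edge is met once from each end; the two contributions complete the
    square.\<close>
  also have "\<dots> = (\<Sum>x\<in>partX G. \<Sum>y\<in>partY G. if adjacent G x y then (f x)\<^sup>2 + f x * f y else 0)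
      + (\<Sum>y\<in>partY G. \<Sum>x\<in>partX G. if adjacent G x y then (f y)\<^sup>2 + f y * f x else 0)"
    unfolding sum.union_disjoint[OF fin dis, folded verts_def,
        of "\<lambda>u. \<Sum>v\<in>verts G. if adjacent G u v then (f u)\<^sup>2 + f u * f v else 0"]
    by (rule arg_cong2[where f = "(+)"]; rule sum.cong[OF refl]) (rule X Y, assumption)+
  also have "(\<Sum>y\<in>partY G. \<Sum>x\<in>partX G. if adjacent G x y then (f y)\<^sup>2 + f y * f x else 0)
      = (\<Sum>x\<in>partX G. \<Sum>y\<in>partY G. if adjacent G x y then (f y)\<^sup>2 + f y * f x else 0)"
    by (rule sum.swap)
  also have "(\<Sum>x\<in>partX G. \<Sum>y\<in>partY G. if adjacent G x y then (f x)\<^sup>2 + f x * f y else 0) + \<dots>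
      = (\<Sum>x\<in>partX G. \<Sum>y\<in>partY G. if adjacent G x y then (f x + f y)\<^sup>2 else 0)"
    unfolding sum.distrib[symmetric]
    by (intro sum.cong refl) (simp add: power2_eq_square algebra_simps)
  finally have form: "(\<Sum>i<N. \<Sum>j<N. ?A $$ (i, j) * f (vs ! i) * f (vs ! j))
      = (\<Sum>x\<in>partX G. \<Sum>y\<in>partY G. if adjacent G x y then (f x + f y)\<^sup>2 else 0)" .
  have "(\<Sum>i<N. \<Sum>j<N. ?A $$ (i, j) * f (vs ! i) * f (vs ! j))
      \<le> Max {\<mu>. eigenvalue ?A \<mu>} * (\<Sum>i<N. (f (vs ! i))\<^sup>2)"
    by (rule quadratic_form_le_Max_eigenvalue[OF A N])
      (auto simp: Aij M_def adjacent_commute[of G])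
  then show ?thesis unfolding form index[of "\<lambda>v. (f v)\<^sup>2"] signless_radius_def .
qed

text \<open>Shift the cycle so that \<open>None\<close> comes last and delete it; the rest is a
  Hamilton path of \<open>G\<close> with both ends in \<open>P\<close>.\<close>

lemma traceable_if_hamiltonian:
  fixes G :: "'a bigraph"
  assumes fin: "finite P" "finite Q" and dis: "P \<inter> Q = {}" and V: "verts G = P \<union> Q"
    and cQ: "Suc (card Q) = n" and cP: "card P = n"
    and ham: "hamiltonian n (cone (adjacent G)) P (insert None (Some ` Q))"
  shows "traceable G"
proof -
  let ?R = "cone (adjacent G)" and ?Y = "insert None (Some ` Q)"
  obtain a b where z: "zigzag n ?R P ?Y a b" and c: "?R (a 0) (b (n - 1))"
    using ham by (auto simp: hamiltonian_def)
  have "None \<in> b ` {..<n}" using zigzagD(2)[OF z] by (auto simp: bij_betw_def)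
  then obtain k where k: "k < n" "b k = None" by (metis imageE lessThan_iff)
  \<comment> \<open>Starting right after the index of \<open>None\<close> moves it to position
    \<open>n - 1\<close>.\<close>
  define p where "p = Suc k mod n"
  have p: "p < n" using k by (simp add: p_def)
  define a' where "a' i = a ((p + i) mod n)" for i
  define b' where "b' i = b ((p + i) mod n)" for i
  have z': "zigzag n ?R P ?Y a' b'"
    unfolding a'_def b'_def
    by (rule zigzag_shift[OF zigzagD(1,2)[OF z] p])
      (use zigzagD(3)[OF z] closed_zigzag[OF z c] in auto)
  have last: "b' (n - 1) = None"
  proof -
    have "(p + (n - 1)) mod n = (Suc k + (n - 1)) mod n" by (simp add: p_def mod_add_left_eq)
    also have "\<dots> = k" using k by simp
    finally show ?thesis using k by (simp add: b'_def)
  qed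
  define c where "c i = the (b' i)" for i
  have b': "b' i = Some (c i)" if "Suc i < n" for i
  proof -
    have "b' i \<noteq> b' (n - 1)"
      using zigzagD(2)[OF z'] that by (auto simp: bij_betw_def dest!: inj_onD)
    then show ?thesis using last by (auto simp: c_def)
  qed
  define w where "w = rec_nat [a' 0] (\<lambda>m xs. xs @ [c m, a' (Suc m)])"
  have w_0: "w 0 = [a' 0]" and w_Suc: "\<And>m. w (Suc m) = w m @ [c m, a' (Suc m)]"
    by (simp_all add: w_def)
  have len: "length (w m) = 2 * m + 1" for m by (induction m) (auto simp: w_0 w_Suc)
  have set_w: "set (w m) = a' ` {..m} \<union> c ` {..<m}" for m
    by (induction m) (auto simp: w_0 w_Suc atMost_Suc lessThan_Suc)
  have last_w: "last (w m) = a' m" for m by (cases m) (auto simp: w_0 w_Suc)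
  have succ: "successively (adjacent G) (w m)" if "m < n" for m
    using that
  proof (induction m)
    case (Suc m)
    have "adjacent G (a' m) (c m)" "adjacent G (c m) (a' (Suc m))"
      using zigzagD(3)[OF z', of m] zigzagD(4)[OF z', of m] b'[of m] Suc.prems
      by (auto simp: adjacent_commute[of G "c m"])
    then show ?case using Suc by (simp add: w_Suc successively_append_iff last_w)
  qed (simp add: w_0)
  have n: "n = Suc (n - 1)" using cQ by simp
  have "a' ` {..n - 1} = P"
    using zigzagD(1)[OF z'] n by (simp add: bij_betw_def lessThan_Suc_atMost[symmetric])
  moreover have "c ` {..<n - 1} = Q"
  proof -
    have "Some ` (c ` {..<n - 1}) = b' ` {..<n - 1}" using b' by (force simp: image_iff)
    also have "\<dots> = b' ` {..<n} - {None}"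
    proof -
      have "{..<n} = insert (n - 1) {..<n - 1}" using n by auto
      moreover have "None \<notin> b' ` {..<n - 1}" using b' by force
      ultimately show ?thesis using last by auto
    qed
    also have "\<dots> = Some ` Q" using zigzagD(2)[OF z'] by (auto simp: bij_betw_def)
    finally show ?thesis by (simp add: inj_image_eq_iff)
  qed
  ultimately have set: "set (w (n - 1)) = verts G" by (simp add: set_w V)
  \<comment> \<open>Distinctness by counting: the list covers all vertices and has exactly as many
    entries.\<close>
  have "card (verts G) = length (w (n - 1))"
    using cP cQ card_Un_disjoint[OF fin dis] unfolding V len by simp
  then have "distinct (w (n - 1))" using set by (metis card_distinct)
  moreover have "w (n - 1) \<noteq> []" using len[of "n - 1"] by auto
  ultimately have "hamilton_path G (w (n - 1))"
    unfolding hamilton_path_def using set succ[of "n - 1"] n by auto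
  then show ?thesis unfolding traceable_def by blast
qed

section \<open>Isomorphisms onto the exceptional graphs\<close>

text \<open>Only pairs across the parts need checking, as no edge lies inside a part on either side.
  Naming the parts \<open>P\<close> and \<open>Q\<close> covers both orientations of
  \<open>G\<close> at once.\<close>

lemma bigraph_isoI:
  assumes G: "bipartite_graph G" and F: "bipartite_graph F"
    and PQ: "P = partX G \<and> Q = partY G \<or> P = partY G \<and> Q = partX G"
    and fP: "bij_betw f P (partX F)" and fQ: "bij_betw f Q (partY F)"
    and adj: "\<And>x y. x \<in> P \<Longrightarrow> y \<in> Q \<Longrightarrow> adjacent F (f x) (f y) \<longleftrightarrow> adjacent G x y"
  shows "bigraph_iso G F"
proof -
  have V: "verts G = P \<union> Q" using PQ by (auto simp: verts_def)
  have disF: "partX F \<inter> partY F = {}" using F by (simp add: bipartite_graph_def)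
  have "bij_betw f (verts G) (verts F)"
    unfolding V verts_def[of F] by (rule bij_betw_combine[OF fP fQ disF])
  moreover have img: "f ` P = partX F" "f ` Q = partY F" using fP fQ by (auto simp: bij_betw_def)
  moreover have "adjacent G u v \<longleftrightarrow> adjacent F (f u) (f v)" if uv: "u \<in> verts G" "v \<in> verts G" for u v
  proof -
    have PP: "\<not> adjacent G u v \<and> \<not> adjacent F (f u) (f v)"
      if "u \<in> P \<and> v \<in> P \<or> u \<in> Q \<and> v \<in> Q"
      using adjacent_parts[OF G, of u v] adjacent_parts[OF F, of "f u" "f v"] that PQ img disF G
      unfolding bipartite_graph_def by blast
    show ?thesis
      using uv PP adj[of u v] adj[of v u] adjacent_commute[of G u v] adjacent_commute[of F "f u" "f v"]
      unfolding V by blast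
  qed
  ultimately show ?thesis using PQ unfolding bigraph_iso_def by blast
qed

lemma adjacent_join [simp]:
  fixes G1 :: "'x bigraph" and G2 :: "'y bigraph"
  shows "adjacent (G1 \<squnion>\<^sub>b G2) (Inl a) (Inl b) \<longleftrightarrow> adjacent G1 a b"
  "adjacent (G1 \<squnion>\<^sub>b G2) (Inr c) (Inr d) \<longleftrightarrow> adjacent G2 c d"
  "adjacent (G1 \<squnion>\<^sub>b G2) (Inl a) (Inr d) \<longleftrightarrow>
    a \<in> partX G1 \<and> d \<in> partY G2 \<or> a \<in> partY G1 \<and> d \<in> partX G2"
  "adjacent (G1 \<squnion>\<^sub>b G2) (Inr d) (Inl a) \<longleftrightarrow>
    a \<in> partX G1 \<and> d \<in> partY G2 \<or> a \<in> partY G1 \<and> d \<in> partX G2"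
proof -
  have l: "{Inl a, Inl b} = Inl ` s \<longleftrightarrow> s = {a, b}" for s :: "'x set"
    using inj_image_eq_iff[OF inj_Inl, of "{a, b}" s] by auto
  have r: "{Inr c, Inr d} = Inr ` s \<longleftrightarrow> s = {c, d}" for s :: "'y set"
    using inj_image_eq_iff[OF inj_Inr, of "{c, d}" s] by auto
  have no: "{Inl u, v} \<noteq> Inr ` s" "{v, Inr w} \<noteq> Inl ` t" for u :: 'x and w :: 'y and v s t
    by blast+
  show "adjacent (G1 \<squnion>\<^sub>b G2) (Inl a) (Inl b) \<longleftrightarrow> adjacent G1 a b"
    by (simp add: adjacent_def bigraph_join_def image_iff doubleton_eq_iff l no)
  show "adjacent (G1 \<squnion>\<^sub>b G2) (Inr c) (Inr d) \<longleftrightarrow> adjacent G2 c d"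
    by (simp add: adjacent_def bigraph_join_def image_iff doubleton_eq_iff r no)
  show *: "adjacent (G1 \<squnion>\<^sub>b G2) (Inl a) (Inr d) \<longleftrightarrow>
    a \<in> partX G1 \<and> d \<in> partY G2 \<or> a \<in> partY G1 \<and> d \<in> partX G2"
    by (auto simp: adjacent_def bigraph_join_def image_iff doubleton_eq_iff no)
  show "adjacent (G1 \<squnion>\<^sub>b G2) (Inr d) (Inl a) \<longleftrightarrow>
    a \<in> partX G1 \<and> d \<in> partY G2 \<or> a \<in> partY G1 \<and> d \<in> partX G2"
    unfolding adjacent_commute[of _ "Inr d"] by (rule *)
qed

lemma bipartite_graph_join:
  assumes "bipartite_graph G1" "bipartite_graph G2"
  shows "bipartite_graph (G1 \<squnion>\<^sub>b G2)"
proof -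
  have "edges (G1 \<squnion>\<^sub>b G2) \<subseteq> {{x, y} | x y. x \<in> partX (G1 \<squnion>\<^sub>b G2) \<and> y \<in> partY (G1 \<squnion>\<^sub>b G2)}"
  proof
    fix e assume "e \<in> edges (G1 \<squnion>\<^sub>b G2)"
    then consider (1) x y where "x \<in> partX G1" "y \<in> partY G1" "e = {Inl x, Inl y}"
      | (2) x y where "x \<in> partX G2" "y \<in> partY G2" "e = {Inr x, Inr y}"
      | (3) x y where "x \<in> partX G1" "y \<in> partY G2" "e = {Inl x, Inr y}"
      | (4) x y where "x \<in> partX G2" "y \<in> partY G1" "e = {Inr x, Inl y}"
      using assms unfolding bigraph_join_def bipartite_graph_def
      by (auto simp: image_iff insert_commute)
    then show "e \<in> {{x, y} | x y. x \<in> partX (G1 \<squnion>\<^sub>b G2) \<and> y \<in> partY (G1 \<squnion>\<^sub>b G2)}"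
      by cases (auto simp: bigraph_join_def)
  qed
  then show ?thesis using assms by (auto simp: bipartite_graph_def bigraph_join_def)
qed

text \<open>\<open>H\<close> is a copy on natural numbers of the subgraph induced by
  \<open>P1\<close> and \<open>Q1\<close>; the hypotheses fix all other adjacencies as in a join
  with an edgeless graph.\<close>

lemma bigraph_iso_join:
  fixes G :: "'a bigraph"
  assumes G: "bipartite_graph G"
    and PQ: "P = partX G \<and> Q = partY G \<or> P = partY G \<and> Q = partX G"
    and P: "P = P1 \<union> P2" "P1 \<inter> P2 = {}" and Q: "Q = Q1 \<union> Q2" "Q1 \<inter> Q2 = {}"
    and 22: "\<And>x y. x \<in> P2 \<Longrightarrow> y \<in> Q2 \<Longrightarrow> \<not> adjacent G x y"
    and 12: "\<And>x y. x \<in> P1 \<Longrightarrow> y \<in> Q2 \<Longrightarrow> adjacent G x y"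
    and 21: "\<And>x y. x \<in> P2 \<Longrightarrow> y \<in> Q1 \<Longrightarrow> adjacent G x y"
  shows "\<exists>H :: nat bigraph. H \<in> bigraphs (card P1) (card Q1) \<and>
    bigraph_iso G (H \<squnion>\<^sub>b edgeless (card P2) (card Q2))"
proof -
  have "finite P" "finite Q" and dis: "P \<inter> Q = {}"
    using G PQ by (auto simp: bipartite_graph_def)
  then have fin: "finite P1" "finite P2" "finite Q1" "finite Q2" using P(1) Q(1) by auto
  obtain h :: "'a \<Rightarrow> nat" where h: "inj_on h (P1 \<union> Q1)"
    using fin finite_imp_inj_to_nat_seg[of "P1 \<union> Q1"] by auto
  obtain h2 where h2: "bij_betw h2 P2 {..<card P2}"
    using ex_bij_betw_finite_nat[OF fin(2)] by (auto simp: lessThan_atLeast0)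
  obtain h3 where h3: "bij_betw h3 Q2 {..<card Q2}"
    using ex_bij_betw_finite_nat[OF fin(4)] by (auto simp: lessThan_atLeast0)
  define H where "H = \<lparr>partX = h ` P1, partY = h ` Q1,
    edges = {{h x, h y} | x y. x \<in> P1 \<and> y \<in> Q1 \<and> adjacent G x y}\<rparr>"
  have h_eq: "h u = h v \<longleftrightarrow> u = v" if "u \<in> P1 \<union> Q1" "v \<in> P1 \<union> Q1" for u v
    using h that by (auto dest: inj_onD)
  have dis1: "h ` P1 \<inter> h ` Q1 = {}" using h_eq dis P(1) Q(1) by blast
  then have H: "bipartite_graph H" using fin by (auto simp: H_def bipartite_graph_def)
  have "inj_on h P1" "inj_on h Q1" using h by (auto intro: inj_on_subset)
  then have cards: "H \<in> bigraphs (card P1) (card Q1)"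
    using H by (simp add: bigraphs_def) (simp add: H_def card_image)
  have H_adj: "adjacent H (h x) (h y) \<longleftrightarrow> adjacent G x y" if "x \<in> P1" "y \<in> Q1" for x y
  proof
    assume "adjacent H (h x) (h y)"
    then obtain x' y' where *: "{h x, h y} = {h x', h y'}" "x' \<in> P1" "y' \<in> Q1" "adjacent G x' y'"
      by (auto simp: adjacent_def H_def)
    have "h x = h x'" "h y = h y'" using *(1-3) dis1 that by (auto simp: doubleton_eq_iff)
    then show "adjacent G x y" using h_eq * that by auto
  next
    assume "adjacent G x y"
    moreover have "edges H = {{h x, h y} | x y. x \<in> P1 \<and> y \<in> Q1 \<and> adjacent G x y}"
      by (simp add: H_def)
    ultimately show "adjacent H (h x) (h y)" using that by (auto simp: adjacent_def[of H])
  qed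
  let ?E = "edgeless (card P2) (card Q2)" and ?F = "H \<squnion>\<^sub>b edgeless (card P2) (card Q2)"
  have E: "bipartite_graph ?E" by (auto simp: bipartite_graph_def edgeless_def)
  define f where "f v = (if v \<in> P1 \<union> Q1 then Inl (h v)
    else Inr (if v \<in> P2 then Inl (h2 v) else Inr (h3 v)))" for v
  have f1: "f v = Inl (h v)" if "v \<in> P1 \<union> Q1" for v using that by (simp add: f_def)
  have f2: "f v = Inr (Inl (h2 v))" if "v \<in> P2" for v using that P Q dis by (auto simp: f_def)
  have f3: "f v = Inr (Inr (h3 v))" if "v \<in> Q2" for v using that P Q dis by (auto simp: f_def)
  have m2: "h2 v < card P2" if "v \<in> P2" for v using h2 that by (auto simp: bij_betw_def)
  have m3: "h3 v < card Q2" if "v \<in> Q2" for v using h3 that by (auto simp: bij_betw_def)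
  have "bij_betw f P (partX ?F)"
  proof -
    have "bij_betw f P1 (Inl ` h ` P1)"
      using h f1 by (auto simp: bij_betw_def inj_on_def image_image intro!: image_cong)
    moreover have "bij_betw f P2 (Inr ` Inl ` {..<card P2})"
      using h2 f2 by (auto simp: bij_betw_def inj_on_def image_image intro!: image_cong)
    ultimately have "bij_betw f (P1 \<union> P2) (Inl ` h ` P1 \<union> Inr ` Inl ` {..<card P2})"
      by (rule bij_betw_combine) auto
    then show ?thesis by (simp add: P(1) bigraph_join_def H_def edgeless_def Plus_def)
  qed
  moreover have "bij_betw f Q (partY ?F)"
  proof -
    have "bij_betw f Q1 (Inl ` h ` Q1)"
      using h f1 by (auto simp: bij_betw_def inj_on_def image_image intro!: image_cong)
    moreover have "bij_betw f Q2 (Inr ` Inr ` {..<card Q2})"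
      using h3 f3 by (auto simp: bij_betw_def inj_on_def image_image intro!: image_cong)
    ultimately have "bij_betw f (Q1 \<union> Q2) (Inl ` h ` Q1 \<union> Inr ` Inr ` {..<card Q2})"
      by (rule bij_betw_combine) auto
    then show ?thesis by (simp add: Q(1) bigraph_join_def H_def edgeless_def Plus_def)
  qed
  moreover have "adjacent ?F (f x) (f y) \<longleftrightarrow> adjacent G x y" if xy: "x \<in> P" "y \<in> Q" for x y
  proof -
    have H_parts: "partX H = h ` P1" "partY H = h ` Q1" by (simp_all add: H_def)
    have E_simps: "Inl i \<in> partX ?E \<longleftrightarrow> i < card P2" "Inr j \<in> partY ?E \<longleftrightarrow> j < card Q2"
      "\<not> adjacent ?E u v" for i j u v
      by (auto simp: edgeless_def adjacent_def)
    consider "x \<in> P1" "y \<in> Q1" | "x \<in> P1" "y \<in> Q2" | "x \<in> P2" "y \<in> Q1" | "x \<in> P2" "y \<in> Q2"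
      using xy P(1) Q(1) by blast
    then show ?thesis
      by cases (simp_all add: f1 f2 f3 H_adj H_parts E_simps 22 12 21 m2 m3)
  qed
  ultimately have "bigraph_iso G ?F"
    by (rule bigraph_isoI[OF G bipartite_graph_join[OF H E] PQ])
  with cards show ?thesis by blast
qed

lemma bigraph_iso_subdivided_claw:
  assumes G: "bipartite_graph G"
    and PQ: "P = partX G \<and> Q = partY G \<or> P = partY G \<and> Q = partX G"
    and a: "bij_betw a {..<4::nat} P" and c: "bij_betw c {..<3::nat} Q"
    and adj: "\<forall>k<4. \<forall>j<3. adjacent G (a k) (c j) \<longleftrightarrow> k = 1 \<or> (k, j) \<in> {(0, 0), (2, 1), (3, 2)}"
  shows "bigraph_iso G subdivided_claw"
proof -
  \<comment> \<open>The centre has index 1 along the path but number 0 in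
    \<open>subdivided_claw\<close>.\<close>
  define p where "p k = (if k = 0 then 1 else if k = 1 then 0 else k)" for k :: nat
  have F: "bipartite_graph subdivided_claw"
    by (auto simp: bipartite_graph_def subdivided_claw_def)
  have p: "bij_betw p {..<4} (partX subdivided_claw)"
    by (rule bij_betw_byWitness[where f' = p]) (auto simp: p_def subdivided_claw_def)
  have q: "bij_betw ((+) 4) {..<3} (partY subdivided_claw)"
    by (rule bij_betw_byWitness[where f' = "\<lambda>k. k - 4"]) (auto simp: subdivided_claw_def)
  define f where "f v = (if v \<in> P then p (inv_into {..<4} a v) else 4 + inv_into {..<3} c v)" for v
  have dis: "P \<inter> Q = {}" using G PQ by (auto simp: bipartite_graph_def)
  have "bij_betw f P (partX subdivided_claw)"
    using bij_betw_trans[OF bij_betw_inv_into[OF a] p]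
    by (rule bij_betw_cong[THEN iffD1, rotated]) (simp add: f_def)
  moreover have "bij_betw f Q (partY subdivided_claw)"
    using bij_betw_trans[OF bij_betw_inv_into[OF c] q]
    by (rule bij_betw_cong[THEN iffD1, rotated]) (use dis in \<open>auto simp: f_def\<close>)
  moreover have "adjacent subdivided_claw (f x) (f y) \<longleftrightarrow> adjacent G x y"
    if xy: "x \<in> P" "y \<in> Q" for x y
  proof -
    obtain k j where k: "k < 4" "x = a k" and j: "j < 3" "y = c j"
      using xy a c by (auto simp: bij_betw_def)
    have "f x = p k" "f y = 4 + j"
      using k j a c xy dis by (auto simp: f_def bij_betw_def inv_into_f_f)
    moreover have "adjacent subdivided_claw (p k) (4 + j) \<longleftrightarrow>
        k = 1 \<or> (k, j) \<in> {(0, 0), (2, 1), (3, 2)}"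
    proof -
      have "k \<in> {0, 1, 2, 3}" "j \<in> {0, 1, 2}" using k j by auto
      then show ?thesis
        by (auto simp: p_def adjacent_def subdivided_claw_def doubleton_eq_iff)
    qed
    ultimately show ?thesis using adj k j by simp
  qed
  ultimately show ?thesis by (rule bigraph_isoI[OF G F PQ])
qed

theorem theorem2p8:
  fixes G :: "'a bigraph" and n :: nat
  assumes "bipartite_graph G"
    and "nearly_balanced G"
    and "n \<ge> 1"
    and "card (verts G) = 2 * n - 1"
    and "signless_radius (quasi_complement G) \<le> real n"
  shows "traceable G
    \<or> (\<exists>F \<in> (\<Union>k \<in> {1..(n - 1) div 2}. S_family n k) \<union> (\<Union>k \<in> {0..<n div 2}. T_family n k).
         bigraph_iso G F)
    \<or> n = 4 \<and> bigraph_iso G subdivided_claw"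
proof (cases "traceable G")
  case False
  have fin: "finite (partX G)" "finite (partY G)" and disXY: "partX G \<inter> partY G = {}"
    using assms(1) by (auto simp: bipartite_graph_def)
  obtain P Q where PQ: "P = partX G \<and> Q = partY G \<or> P = partY G \<and> Q = partX G"
    and cPQ: "card P = card Q + 1"
    using assms(2) unfolding nearly_balanced_def by blast
  have finP: "finite P" and finQ: "finite Q" and dis: "P \<inter> Q = {}" and V: "verts G = P \<union> Q"
    using PQ fin disXY by (auto simp: verts_def)
  have cP: "card P = n" and cQ: "Suc (card Q) = n"
    using assms(3,4) cPQ card_Un_disjoint[OF finP finQ dis] V by auto
  have bound: "(\<Sum>x\<in>P. \<Sum>y\<in>Q. if \<not> adjacent G x y then (f x + f y)\<^sup>2 else 0)
      \<le> real n * (\<Sum>v\<in>P \<union> Q. (f v)\<^sup>2)" for f :: "'a \<Rightarrow> real"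
  proof -
    let ?X = "partX G" and ?Y = "partY G" and ?C = "quasi_complement G"
    have parts: "partX ?C = ?X" "partY ?C = ?Y" "verts ?C = P \<union> Q"
      using V by (simp_all add: quasi_complement_def verts_def)
    have "P \<noteq> {}" using cP assms(3) by auto
    then have "(\<Sum>x\<in>?X. \<Sum>y\<in>?Y. if adjacent ?C x y then (f x + f y)\<^sup>2 else 0)
        \<le> signless_radius ?C * (\<Sum>v\<in>P \<union> Q. (f v)\<^sup>2)"
      using edge_form_le_signless_radius[OF bipartite_graph_quasi_complement[OF assms(1)], of f]
      unfolding parts by auto
    also have "\<dots> \<le> real n * (\<Sum>v\<in>P \<union> Q. (f v)\<^sup>2)"
      by (intro mult_right_mono assms(5) sum_nonneg) auto
    also have "(\<Sum>x\<in>?X. \<Sum>y\<in>?Y. if adjacent ?C x y then (f x + f y)\<^sup>2 else 0)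
        = (\<Sum>x\<in>?X. \<Sum>y\<in>?Y. if \<not> adjacent G x y then (f x + f y)\<^sup>2 else 0)"
      by (intro sum.cong refl) (simp add: adjacent_quasi_complement[OF assms(1)])
    \<comment> \<open>The larger part \<open>P\<close> may be either part of \<open>G\<close>; the
      form is symmetric under their exchange.\<close>
    also have "\<dots> = (\<Sum>x\<in>P. \<Sum>y\<in>Q. if \<not> adjacent G x y then (f x + f y)\<^sup>2 else 0)"
    proof (cases "P = ?X \<and> Q = ?Y")
      case False
      then have "P = ?Y" "Q = ?X" using PQ by auto
      have "(\<Sum>x\<in>?X. \<Sum>y\<in>?Y. if \<not> adjacent G x y then (f x + f y)\<^sup>2 else 0)
          = (\<Sum>y\<in>?Y. \<Sum>x\<in>?X. if \<not> adjacent G x y then (f x + f y)\<^sup>2 else 0)"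
        by (rule sum.swap)
      also have "\<dots> = (\<Sum>y\<in>?Y. \<Sum>x\<in>?X. if \<not> adjacent G y x then (f y + f x)\<^sup>2 else 0)"
        by (intro sum.cong refl) (metis adjacent_commute add.commute)
      finally show ?thesis unfolding \<open>P = ?Y\<close> \<open>Q = ?X\<close> .
    qed simp
    finally show ?thesis .
  qed
  have nonham: "\<not> hamiltonian n (cone (adjacent G)) P (insert None (Some ` Q))"
    using traceable_if_hamiltonian[OF finP finQ dis V cQ cP] False by blast
  from nontraceable_structure[OF finP finQ dis cP cQ bound nonham] show ?thesis
  proof (elim disjE)
    assume "\<exists>A\<subseteq>P. \<exists>B\<subseteq>Q. A \<noteq> {} \<and> B \<noteq> {} \<and> card A + card B = n \<and>
      (\<forall>x\<in>A. \<forall>y\<in>Q. adjacent G x y \<longleftrightarrow> y \<notin> B) \<and> (\<forall>y\<in>B. \<forall>x\<in>P. adjacent G x y \<longleftrightarrow> x \<notin> A)"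
    then obtain A B where AB: "A \<subseteq> P" "B \<subseteq> Q" "A \<noteq> {}" "B \<noteq> {}" "card A + card B = n"
      and AQ: "\<forall>x\<in>A. \<forall>y\<in>Q. adjacent G x y \<longleftrightarrow> y \<notin> B"
      and PB: "\<forall>y\<in>B. \<forall>x\<in>P. adjacent G x y \<longleftrightarrow> x \<notin> A"
      by blast
    have adj: "x \<in> A \<Longrightarrow> y \<in> B \<Longrightarrow> \<not> adjacent G x y"
        "x \<in> P - A \<Longrightarrow> y \<in> B \<Longrightarrow> adjacent G x y" "x \<in> A \<Longrightarrow> y \<in> Q - B \<Longrightarrow> adjacent G x y" for x y
      using AB(1,2) AQ PB by blast+
    have split: "P = (P - A) \<union> A" "(P - A) \<inter> A = {}" "Q = (Q - B) \<union> B" "(Q - B) \<inter> B = {}"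
      using AB(1,2) by blast+
    have QP: "Q = partX G \<and> P = partY G \<or> Q = partY G \<and> P = partX G" using PQ by blast
    have finA: "finite A" and finB: "finite B" using AB finP finQ by (auto intro: finite_subset)
    have pos: "card A > 0" "card B > 0" using AB finA finB by (auto simp: card_gt_0_iff)
    have cPA: "card (P - A) = card B" and cQB: "card (Q - B) = card A - 1"
      using AB cP cQ card_Diff_subset[OF finA AB(1)] card_Diff_subset[OF finB AB(2)] by auto
    have "\<exists>F \<in> (\<Union>k \<in> {1..(n - 1) div 2}. S_family n k) \<union> (\<Union>k \<in> {0..<n div 2}. T_family n k).
      bigraph_iso G F"
    \<comment> \<open>A small \<open>B\<close> gives an S-type graph with \<open>k = card B\<close>
      and the parts interchanged. Otherwise \<open>card A = n - card B\<close> is small enough for a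
      T-type graph with \<open>k = card A - 1\<close>.\<close>
    proof (cases "card B \<le> (n - 1) div 2")
      case True
      have "\<exists>H :: nat bigraph. H \<in> bigraphs (card (Q - B)) (card (P - A)) \<and>
          bigraph_iso G (H \<squnion>\<^sub>b edgeless (card B) (card A))"
        by (rule bigraph_iso_join[OF assms(1) QP split(3,4,1,2)])
          (subst adjacent_commute, erule (1) adj)+
      moreover have "card (Q - B) = n - card B - 1" "card A = n - card B"
        using cQB AB(5) by auto
      ultimately have "\<exists>F \<in> S_family n (card B). bigraph_iso G F"
        unfolding S_family_def cPA by auto
      moreover have "card B \<in> {1..(n - 1) div 2}" using True pos by simp
      ultimately show ?thesis by blast
    next
      case False
      define k where "k = card A - 1"
      have "\<exists>H :: nat bigraph. H \<in> bigraphs (card (P - A)) (card (Q - B)) \<and>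
          bigraph_iso G (H \<squnion>\<^sub>b edgeless (card A) (card B))"
        by (rule bigraph_iso_join[OF assms(1) PQ split]) (fact adj)+
      moreover have "card (P - A) = n - k - 1" "card (Q - B) = k" "card A = k + 1" "card B = n - k - 1"
        using cPA cQB AB(5) pos by (auto simp: k_def)
      ultimately have "\<exists>F \<in> T_family n k. bigraph_iso G F"
        unfolding T_family_def by auto
      moreover have "k \<in> {0..<n div 2}" using False AB(5) pos by (auto simp: k_def)
      ultimately show ?thesis by blast
    qed
    then show ?thesis by blast
  next
    assume "n = 4 \<and> (\<exists>a c. bij_betw a {..<4} P \<and> bij_betw c {..<3} Q \<and>
      (\<forall>k<4. \<forall>j<3. adjacent G (a k) (c j) \<longleftrightarrow> k = 1 \<or> (k, j) \<in> {(0::nat, 0::nat), (2, 1), (3, 2)}))"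
    then obtain a c where "n = 4" "bij_betw a {..<4} P" "bij_betw c {..<3} Q"
      "\<forall>k<4. \<forall>j<3. adjacent G (a k) (c j) \<longleftrightarrow> k = 1 \<or> (k, j) \<in> {(0::nat, 0::nat), (2, 1), (3, 2)}"
      by blast
    then show ?thesis using bigraph_iso_subdivided_claw[OF assms(1) PQ] by blast
  qed
qed simp

end
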